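(* Let $n$ be a positive integer. The quadratic unitary Cayley graph $G_n$ admits pretty good fractional revival if and only if $n\in\{2,8,2p\}$ for some prime $p$.
   Context: The quadratic unitary Cayley graph $G_n$ is the simple undirected graph with vertex set $\mathbb{Z}_n$ in which two distinct vertices $a,b$ are adjacent if and only if $a-b\equiv u^2$ or $a-b\equiv -u^2 \pmod n$ for some integer $u$ with $1\le u\le n-1$ and $\gcd(u,n)=1$. For a finite simple undirected graph $\Gamma$ with adjacency matrix $A$, the transition matrix is $H(t)=\exp(-\mathbf{i}tA)$, $t\in\mathbb{R}$, where $\mathbf{i}=\sqrt{-1}$. For a vertex $a$, $\mathbf{e}_a$ is the standard basis column vector indexed by the vertices with entry $1$ at $a$ and $0$ elsewhere. $\Gamma$ admits pretty good fractional revival (PGFR) from a vertex $a$ to another vertex $b\ne a$ if there is a real sequence $\{t_k\}$ such that $\lim_{k\to\infty}H(t_k)\mathbf{e}_a=\alpha\mathbf{e}_a+\beta\mathbf{e}_b$ for some complex numbers $\alpha,\beta$ with $\beta\neq 0$ and $|\alpha|^2+|\beta|^2=1$. $\Gamma$ admits PGFR if it does so from some vertex $a$ to some other vertex $b$. *)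

theory Defs
  imports
    Complex_Main
    "HOL-Number_Theory.Cong"
    "Jordan_Normal_Form.Matrix"
begin

text \<open>A finite simple graph of order \<open>n\<close> has vertex set \<open>{0..<n}\<close> and is given by its
  adjacency relation. Since matrix indices of \<open>complex mat\<close> also start at 0, vertices serve
  directly as row and column indices.\<close>

definition adj_mat :: "nat \<Rightarrow> (nat \<Rightarrow> nat \<Rightarrow> bool) \<Rightarrow> complex mat" where
  "adj_mat n E = mat n n (\<lambda>(i, j). if E i j then 1 else 0)"

text \<open>The power series of the exponential, summed entry by entry, for a square matrix \<open>M\<close>;
  every entry series converges, see \<open>summable_mat_exp\<close> below.\<close>

definition mat_exp :: "complex mat \<Rightarrow> complex mat" where
  "mat_exp M = mat (dim_row M) (dim_col M)
     (\<lambda>(i, j). \<Sum>k. (M ^\<^sub>m k) $$ (i, j) / fact k)"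

definition transition_mat :: "nat \<Rightarrow> (nat \<Rightarrow> nat \<Rightarrow> bool) \<Rightarrow> real \<Rightarrow> complex mat" where
  "transition_mat n E t = mat_exp ((- \<i> * complex_of_real t) \<cdot>\<^sub>m adj_mat n E)"

text \<open>Convergence of vectors in the finite-dimensional space of \<open>n\<close>-vectors is entrywise
  convergence.\<close>

definition pgfr_from_to :: "nat \<Rightarrow> (nat \<Rightarrow> nat \<Rightarrow> bool) \<Rightarrow> nat \<Rightarrow> nat \<Rightarrow> bool" where
  "pgfr_from_to n E a b \<longleftrightarrow> a < n \<and> b < n \<and> b \<noteq> a \<and>
     (\<exists>(t :: nat \<Rightarrow> real) (\<alpha> :: complex) (\<beta> :: complex).
        \<beta> \<noteq> 0 \<and> (cmod \<alpha>)\<^sup>2 + (cmod \<beta>)\<^sup>2 = 1 \<and>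
        (\<forall>v<n. (\<lambda>k. (transition_mat n E (t k) *\<^sub>v unit_vec n a) $ v)
           \<longlonglongrightarrow> (\<alpha> \<cdot>\<^sub>v unit_vec n a + \<beta> \<cdot>\<^sub>v unit_vec n b) $ v))"

definition admits_pgfr :: "nat \<Rightarrow> (nat \<Rightarrow> nat \<Rightarrow> bool) \<Rightarrow> bool" where
  "admits_pgfr n E \<longleftrightarrow> (\<exists>a b. pgfr_from_to n E a b)"

text \<open>Residue classes modulo \<open>n\<close> are represented by \<open>0, \<dots>, n - 1\<close>.\<close>

definition quc_adj :: "nat \<Rightarrow> nat \<Rightarrow> nat \<Rightarrow> bool" where
  "quc_adj n a b \<longleftrightarrow> a < n \<and> b < n \<and> a \<noteq> b \<and>
     (\<exists>u::int. 1 \<le> u \<and> u \<le> int n - 1 \<and> gcd u (int n) = 1 \<and>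
        ([int a - int b = u\<^sup>2] (mod int n) \<or> [int a - int b = - u\<^sup>2] (mod int n)))"

lemma quc_adj_irrefl: "\<not> quc_adj n a a"
  by (simp add: quc_adj_def)

lemma quc_adj_sym:
  assumes "quc_adj n a b"
  shows "quc_adj n b a"
proof -
  have neg: "[y - x = - c] (mod m)" if "[x - y = c] (mod m)" for x y c m :: int
    using that by (metis cong_minus_minus_iff minus_diff_eq)
  from assms[unfolded quc_adj_def] have ab: "a < n" "b < n" "b \<noteq> a" by simp_all
  from assms[unfolded quc_adj_def, THEN conjunct2, THEN conjunct2, THEN conjunct2]
  show ?thesis
    unfolding quc_adj_def
  proof (elim exE, intro conjI ab exI)
    fix u :: int
    assume u: "1 \<le> u \<and> u \<le> int n - 1 \<and> gcd u (int n) = 1 \<and>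
        ([int a - int b = u\<^sup>2] (mod int n) \<or> [int a - int b = - u\<^sup>2] (mod int n))"
    show "1 \<le> u" "u \<le> int n - 1" "gcd u (int n) = 1"
      by (rule u[THEN conjunct1] u[THEN conjunct2, THEN conjunct1]
          u[THEN conjunct2, THEN conjunct2, THEN conjunct1])+
    show "[int b - int a = u\<^sup>2] (mod int n) \<or> [int b - int a = - u\<^sup>2] (mod int n)"
      using u[THEN conjunct2, THEN conjunct2, THEN conjunct2]
    proof
      assume "[int a - int b = u\<^sup>2] (mod int n)"
      from neg[OF this] show ?thesis by (rule disjI2)
    next
      assume "[int a - int b = - u\<^sup>2] (mod int n)"
      from neg[OF this] show ?thesis unfolding minus_minus by (rule disjI1)
    qed
  qed
qed

lemma summable_mat_exp:
  fixes M :: "complex mat"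
  assumes M: "M \<in> carrier_mat n n" and ij: "i < n" "j < n"
  shows "summable (\<lambda>k. (M ^\<^sub>m k) $$ (i, j) / fact k)"
proof -
  define c where "c = (\<Sum>p<n. \<Sum>q<n. cmod (M $$ (p, q)))"
  have c0: "c \<ge> 0" unfolding c_def by (intro sum_nonneg) auto
  have entry: "cmod (M $$ (p, q)) \<le> c" if "p < n" "q < n" for p q
  proof -
    have "cmod (M $$ (p, q)) \<le> (\<Sum>q<n. cmod (M $$ (p, q)))"
      using that by (intro member_le_sum) auto
    also have "\<dots> \<le> c"
      unfolding c_def using that
      by (intro member_le_sum[of p _ "\<lambda>p. \<Sum>q<n. cmod (M $$ (p, q))"] sum_nonneg) auto
    finally show ?thesis .
  qed
  have bound: "cmod ((M ^\<^sub>m k) $$ (p, q)) \<le> (real n * c) ^ k" if "p < n" "q < n" for k p q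
    using that
  proof (induction k arbitrary: p q)
    case 0
    have "dim_row M = n" using M by simp
    with 0 show ?case by (simp add: one_mat_def)
  next
    case (Suc k)
    have dims: "dim_row M = n" "dim_col M = n" "dim_row (M ^\<^sub>m k) = n" "dim_col (M ^\<^sub>m k) = n"
      using M by auto
    have "(M ^\<^sub>m Suc k) $$ (p, q) = (\<Sum>r<n. (M ^\<^sub>m k) $$ (p, r) * M $$ (r, q))"
      using Suc.prems dims by (simp add: scalar_prod_def atLeast0LessThan)
    also have "cmod \<dots> \<le> (\<Sum>r<n. cmod ((M ^\<^sub>m k) $$ (p, r) * M $$ (r, q)))"
      by (rule norm_sum)
    also have "\<dots> \<le> (\<Sum>r<n. (real n * c) ^ k * c)"
    proof (rule sum_mono)
      fix r assume "r \<in> {..<n}"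
      then have r: "r < n" by simp
      show "cmod ((M ^\<^sub>m k) $$ (p, r) * M $$ (r, q)) \<le> (real n * c) ^ k * c"
        unfolding norm_mult
        by (rule mult_mono[OF Suc.IH[OF Suc.prems(1) r] entry[OF r Suc.prems(2)]])
           (simp_all add: c0)
    qed
    also have "\<dots> = (real n * c) ^ Suc k"
      by (simp only: sum_constant card_lessThan power_Suc) (simp only: mult_ac)
    finally show ?case .
  qed
  have "summable (\<lambda>k. inverse (fact k) * (real n * c) ^ k)"
    by (rule summable_exp)
  then show ?thesis
  proof (rule summable_comparison_test'[where N = 0])
    fix k
    have "cmod ((M ^\<^sub>m k) $$ (i, j) / fact k) = inverse (fact k) * cmod ((M ^\<^sub>m k) $$ (i, j))"
      by (simp add: divide_inverse norm_mult norm_inverse norm_fact)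
    also have "\<dots> \<le> inverse (fact k) * (real n * c) ^ k"
      by (rule mult_left_mono[OF bound[OF ij]]) simp
    finally show "cmod ((M ^\<^sub>m k) $$ (i, j) / fact k) \<le> inverse (fact k) * (real n * c) ^ k" .
  qed
qed

end

theory Submission
  imports
    Defs
    "HOL-Number_Theory.Number_Theory"
    "HOL-Analysis.Kronecker_Approximation_Theorem"
    "HOL-Library.Real_Mod"
begin

text \<open>
  The graph is circulant, so the characters of \<open>\<int>/n\<close> diagonalise its adjacency matrix; write
  \<open>\<lambda>\<^sub>j\<close> for the eigenvalues. Since \<open>\<lambda>\<^sub>j = \<lambda>\<^sub>-\<^sub>j\<close>, fractional revival can only happen between antipodal
  vertices of a graph of even order, and it amounts to a sequence \<open>t\<^sub>k\<close> along which
  \<open>exp (-\<i> t\<^sub>k \<lambda>\<^sub>j)\<close> tends to \<open>\<gamma>\<^sub>0\<close> for even \<open>j\<close> and to a different limit \<open>\<gamma>\<^sub>1\<close> for odd \<open>j\<close>.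

  If \<open>2 p\<close> divides \<open>n\<close> for a prime \<open>p\<close>, the eigenvalues at \<open>j, j + n/p, j + 2n/p, \<dots>\<close>, whose indices all have
  the same parity, sum to zero, because all connecting elements are units. Hence \<open>\<gamma>\<^sub>0\<close> and \<open>\<gamma>\<^sub>1\<close>
  are \<open>p\<close>-th roots of unity; two such primes would force \<open>\<gamma>\<^sub>0 = \<gamma>\<^sub>1 = 1\<close>, so \<open>n = 2 p\<^sup>k\<close>. If \<open>k \<ge> 2\<close>
  (and \<open>n \<noteq> 8\<close>), the connection set is invariant under translation by \<open>n/p\<close>, which
  makes \<open>\<lambda>\<^sub>j\<close> vanish whenever \<open>p\<close> does not divide \<open>j\<close>; for \<open>p = 2\<close> also \<open>\<lambda>\<^sub>j = 0\<close> at \<open>j = n/4\<close>. So again \<open>\<gamma>\<^sub>0 = \<gamma>\<^sub>1 = 1\<close>.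

  Conversely, for \<open>n = 2 p\<close> with \<open>p\<close> odd one has \<open>\<lambda>\<^sub>j\<^sub>+\<^sub>p = -\<lambda>\<^sub>j\<close>, and the eigenvalues of even index are \<open>p - 1, -1\<close> if
  \<open>-1\<close> is a nonresidue, and \<open>(p - 1)/2\<close> and \<open>(-1 \<plusminus> sqrt p)/2\<close> otherwise by the quadratic Gauss sum. Suitable times
  then come from Kronecker's theorem and the irrationality of \<open>sqrt p\<close>, as they do for \<open>n = 8\<close> with \<open>sqrt 2\<close>.
\<close>

section \<open>Circulant graphs\<close>

definition rot :: "nat \<Rightarrow> int \<Rightarrow> complex" where
  "rot n x = cis (2 * pi * real_of_int x / real n)"

lemma rot_0 [simp]: "rot n 0 = 1"
  by (simp add: rot_def)

lemma norm_rot [simp]: "norm (rot n x) = 1"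
  by (simp add: rot_def)

lemma rot_add: "rot n (x + y) = rot n x * rot n y"
  by (simp add: rot_def cis_mult distrib_left add_divide_distrib)

lemma rot_minus: "rot n (- x) = cnj (rot n x)"
  by (simp add: rot_def cis_cnj)

lemma Re_rot: "Re (rot n x) = cos (2 * pi * real_of_int x / real n)"
  by (simp add: rot_def)

lemma rot_mult_nat: "rot n (int j * x) = rot n x ^ j"
  unfolding rot_def Complex.DeMoivre by (rule arg_cong[where f = cis]) simp

lemma rot_eq_1_iff:
  assumes "n > 0"
  shows "rot n x = 1 \<longleftrightarrow> int n dvd x"
proof -
  have "rot n x = 1 \<longleftrightarrow> (\<exists>k::int. real_of_int x = real_of_int (int n * k))"
    using assms by (simp add: rot_def cis_eq_1_iff field_simps)
  then show ?thesis
    unfolding of_int_eq_iff dvd_def .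
qed

lemma rot_cong:
  assumes "n > 0" "[x = y] (mod int n)"
  shows "rot n x = rot n y"
proof -
  have "rot n (x - y) = 1"
    using assms by (simp add: rot_eq_1_iff cong_iff_dvd_diff)
  then show ?thesis
    using rot_add[of n "x - y" y] by simp
qed

lemma rot_cancel: "m > 0 \<Longrightarrow> rot (m * n) (int m * x) = rot n x"
  unfolding rot_def by (rule arg_cong[where f = cis]) simp

text \<open>Orthogonality of characters: a geometric sum whose ratio \<open>rot n x\<close> is an
  \<open>n\<close>-th root of unity.\<close>

lemma sum_rot:
  assumes "n > 0"
  shows "(\<Sum>j<n. rot n (int j * x)) = (if int n dvd x then of_nat n else 0)"
proof (cases "int n dvd x")
  case True
  then show ?thesis
    using assms rot_eq_1_iff[of n x] by (simp add: rot_mult_nat)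
next
  case False
  then have "rot n x \<noteq> 1"
    using assms by (simp add: rot_eq_1_iff)
  moreover have "rot n x ^ n = 1"
    using assms rot_eq_1_iff[of n "int n * x"] by (simp add: rot_mult_nat)
  ultimately show ?thesis
    using False by (simp add: rot_mult_nat geometric_sum)
qed

section \<open>Spectral decomposition of a circulant graph and of its transition matrix\<close>

locale circulant =
  fixes n :: nat and S :: "int set" and E :: "nat \<Rightarrow> nat \<Rightarrow> bool"
  assumes pos: "n > 0"
    and S_range: "S \<subseteq> {0..<int n}"
    and S_sym: "s \<in> S \<Longrightarrow> (- s) mod int n \<in> S"
    and adj: "E i j \<longleftrightarrow> i < n \<and> j < n \<and> (int i - int j) mod int n \<in> S"
begin

definition ev :: "int \<Rightarrow> real" where
  "ev j = (\<Sum>s\<in>S. cos (2 * pi * real_of_int (j * s) / real n))"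

lemma finite_S: "finite S"
  using S_range finite_subset by blast

lemma mod_S: "s \<in> S \<Longrightarrow> s mod int n = s"
  using S_range by (auto simp: subset_iff)

text \<open>By \<open>S_sym\<close>, negation modulo \<open>n\<close> is an involution of
  \<open>S\<close>. This is what makes the eigenvalues real.\<close>

lemma sum_rot_neg: "(\<Sum>s\<in>S. rot n (j * (- s))) = (\<Sum>s\<in>S. rot n (j * s))"
proof (rule sum.reindex_bij_witness[where i = "\<lambda>s. (- s) mod int n" and j = "\<lambda>s. (- s) mod int n"])
  fix s assume s: "s \<in> S"
  show "- (- s mod int n) mod int n = s"
    using mod_S[OF s] by (simp add: mod_minus_eq)
  then show "- (- s mod int n) mod int n = s" .
  show "- s mod int n \<in> S" using S_sym s .
  then show "- s mod int n \<in> S" .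
  show "rot n (j * (- s mod int n)) = rot n (j * - s)"
    by (rule rot_cong[OF pos], rule cong_scalar_left) (simp add: cong_def)
qed

lemma ev_rot: "complex_of_real (ev j) = (\<Sum>s\<in>S. rot n (j * s))"
proof -
  have "cnj (\<Sum>s\<in>S. rot n (j * s)) = (\<Sum>s\<in>S. rot n (j * s))"
    using sum_rot_neg[of j] by (simp add: rot_minus)
  then have "(\<Sum>s\<in>S. rot n (j * s)) \<in> \<real>"
    by (simp add: Reals_cnj_iff)
  then have "(\<Sum>s\<in>S. rot n (j * s)) = complex_of_real (Re (\<Sum>s\<in>S. rot n (j * s)))"
    by (simp only: of_real_Re)
  then show ?thesis
    by (simp only: ev_def Re_rot Re_sum)
qed

lemma ev_minus: "ev (- j) = ev j"
  by (simp add: ev_def)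

lemma ev_cong:
  assumes "[i = j] (mod int n)"
  shows "ev i = ev j"
proof -
  have "rot n (i * s) = rot n (j * s)" for s
    using assms pos by (intro rot_cong) (simp_all add: cong_scalar_right)
  then have "complex_of_real (ev i) = complex_of_real (ev j)"
    by (simp add: ev_rot)
  then show ?thesis by simp
qed

text \<open>The eigenvector equation for the \<open>j\<close>-th character: \<open>r\<close> is a
  neighbour of \<open>b\<close> exactly when \<open>r - b\<close> lies in \<open>S\<close> modulo
  \<open>n\<close>. The free shift \<open>x\<close> becomes the row index in
  \<open>adj_power\<close>.\<close>

lemma sum_neighbours:
  assumes "b < n"
  shows "(\<Sum>r<n. rot n (j * (x - int r)) * (if E r b then 1 else 0)) = rot n (j * (x - int b)) * ev j"
proof -
  have "(\<Sum>r<n. rot n (j * (x - int r)) * (if E r b then 1 else 0))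
      = (\<Sum>r | r < n \<and> E r b. rot n (j * (x - int r)))"
    by (rule sum.mono_neutral_cong_right) auto
  also have "\<dots> = (\<Sum>s\<in>S. rot n (j * (x - int b - s)))"
  proof (rule sum.reindex_bij_witness[where i = "\<lambda>s. nat ((s + int b) mod int n)"
        and j = "\<lambda>r. (int r - int b) mod int n"])
    fix r assume r: "r \<in> {r. r < n \<and> E r b}"
    show "nat (((int r - int b) mod int n + int b) mod int n) = r"
      using r by (simp add: mod_add_left_eq)
    show "(int r - int b) mod int n \<in> S"
      using r adj by blast
    show "rot n (j * (x - int b - (int r - int b) mod int n)) = rot n (j * (x - int r))"
    proof (rule rot_cong[OF pos], rule cong_scalar_left)
      have "[x - int b - (int r - int b) mod int n = x - int b - (int r - int b)] (mod int n)"
        by (intro cong_diff) (simp_all add: cong_def)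
      then show "[x - int b - (int r - int b) mod int n = x - int r] (mod int n)"
        by simp
    qed
  next
    fix s assume s: "s \<in> S"
    have m: "int (nat ((s + int b) mod int n)) = (s + int b) mod int n"
      using pos by simp
    show inv: "(int (nat ((s + int b) mod int n)) - int b) mod int n = s"
      unfolding m using mod_S[OF s] by (simp add: mod_diff_left_eq)
    have "nat ((s + int b) mod int n) < n"
      using pos by (simp add: nat_less_iff)
    then show "nat ((s + int b) mod int n) \<in> {r. r < n \<and> E r b}"
      using inv s assms by (simp add: adj)
  qed
  also have "\<dots> = rot n (j * (x - int b)) * (\<Sum>s\<in>S. rot n (j * (- s)))"
    unfolding sum_distrib_left
    by (intro sum.cong refl) (simp add: rot_add[symmetric] algebra_simps)
  finally show ?thesis
    by (simp only: sum_rot_neg ev_rot)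
qed

lemma dvd_diff_vertices: "a < n \<Longrightarrow> b < n \<Longrightarrow> int n dvd int a - int b \<longleftrightarrow> a = b"
    using zdvd_imp_le[of "int n" "int a - int b"] zdvd_imp_le[of "int n" "int b - int a"]
      dvd_diff_commute[of "int n" "int a" "int b"] by (cases a b rule: linorder_cases) auto

text \<open>For \<open>k = 0\<close> orthogonality of characters yields the identity matrix; in the
  induction step \<open>sum_neighbours\<close> supplies one more factor
  \<open>c * ev j\<close>.\<close>

lemma adj_power:
  assumes "a < n" "b < n"
  shows "((c \<cdot>\<^sub>m adj_mat n E) ^\<^sub>m k) $$ (a, b)
    = (\<Sum>j<n. (c * ev (int j)) ^ k * rot n (int j * (int a - int b))) / of_nat n"
  using assms
proof (induction k arbitrary: a b)
  case 0
  have "int n dvd int a - int b \<longleftrightarrow> a = b"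
    using 0 by (rule dvd_diff_vertices)
  then show ?case
    using 0 pos sum_rot[OF pos, of "int a - int b"] by (simp add: adj_mat_def)
next
  case (Suc k)
  let ?M = "c \<cdot>\<^sub>m adj_mat n E"
  have dims: "dim_row ?M = n" "dim_col ?M = n"
    by (simp_all add: adj_mat_def)
  have M: "?M $$ (r, b) = c * (if E r b then 1 else 0)" if "r < n" for r
    using that Suc.prems by (simp add: adj_mat_def)
  have "(?M ^\<^sub>m Suc k) $$ (a, b) = (\<Sum>r<n. (?M ^\<^sub>m k) $$ (a, r) * ?M $$ (r, b))"
    using Suc.prems dims by (simp add: scalar_prod_def atLeast0LessThan)
  also have "\<dots> = (\<Sum>r<n. (\<Sum>j<n. (c * ev (int j)) ^ k * rot n (int j * (int a - int r))) / of_nat n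
      * (c * (if E r b then 1 else 0)))"
    using Suc.IH[OF Suc.prems(1)] M by (intro sum.cong) simp_all
  also have "\<dots> = (\<Sum>r<n. \<Sum>j<n. (c * ev (int j)) ^ k * c *
      (rot n (int j * (int a - int r)) * (if E r b then 1 else 0))) / of_nat n"
    unfolding sum_divide_distrib sum_distrib_right
    by (intro sum.cong refl) simp
  also have "\<dots> = (\<Sum>j<n. (c * ev (int j)) ^ k * c *
      (\<Sum>r<n. rot n (int j * (int a - int r)) * (if E r b then 1 else 0))) / of_nat n"
    by (subst sum.swap) (simp only: sum_distrib_left)
  also have "\<dots> = (\<Sum>j<n. (c * ev (int j)) ^ Suc k * rot n (int j * (int a - int b))) / of_nat n"
    unfolding sum_neighbours[OF Suc.prems(2)] by (simp add: mult_ac)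
  finally show ?case .
qed

text \<open>The spectral formula for powers is a finite sum over \<open>j\<close>, so the
  exponential series can be summed separately for each eigenvalue.\<close>

lemma transition_entry:
  assumes "a < n" "b < n"
  shows "transition_mat n E t $$ (a, b)
    = (\<Sum>j<n. cis (- t * ev (int j)) * rot n (int j * (int a - int b))) / of_nat n"
proof -
  let ?c = "- \<i> * complex_of_real t"
  have "(\<lambda>k. (\<Sum>j<n. (?c * ev (int j)) ^ k /\<^sub>R fact k * rot n (int j * (int a - int b))) / of_nat n)
     sums ((\<Sum>j<n. exp (?c * ev (int j)) * rot n (int j * (int a - int b))) / of_nat n)"
    by (intro sums_divide sums_sum sums_mult2 exp_converges)
  moreover have "(\<lambda>k. (\<Sum>j<n. (?c * ev (int j)) ^ k /\<^sub>R fact k * rot n (int j * (int a - int b))) / of_nat n)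
     = (\<lambda>k. ((?c \<cdot>\<^sub>m adj_mat n E) ^\<^sub>m k) $$ (a, b) / fact k)"
    unfolding adj_power[OF assms] 
    by (rule ext) (simp add: sum_distrib_left sum_distrib_right scaleR_conv_of_real divide_inverse mult_ac)
  moreover have "exp (?c * ev (int j)) = cis (- t * ev (int j))" for j
    by (simp add: cis_conv_exp mult_ac)
  ultimately show ?thesis
    using assms by (simp add: transition_mat_def mat_exp_def adj_mat_def sums_iff)
qed

lemma transition_vec:
  assumes "a < n" "v < n"
  shows "(transition_mat n E t *\<^sub>v unit_vec n a) $ v = transition_mat n E t $$ (v, a)"
proof -
  have d: "dim_row (transition_mat n E t) = n" "dim_col (transition_mat n E t) = n"
    by (simp_all add: transition_mat_def mat_exp_def adj_mat_def)
  then show ?thesis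
    using assms by (simp add: scalar_prod_right_unit)
qed

text \<open>Inverts \<open>transition_entry\<close>: a single column already determines the phases
  of all eigenvalues.\<close>

lemma fourier_inversion:
  assumes a: "a < n"
  shows "cis (- t * ev j) = (\<Sum>v<n. transition_mat n E t $$ (v, a) * rot n (- j * (int v - int a)))"
proof -
  \<comment> \<open>The index \<open>j\<close> is any integer, whereas the spectral sum runs over
    \<open>{..<n}\<close>; so \<open>j\<close> is first reduced modulo \<open>n\<close>.\<close>
  define i where "i = nat (j mod int n)"
  have i: "i < n" "int i = j mod int n"
    using pos by (simp_all add: i_def nat_less_iff)
  have c: "[j = int i] (mod int n)"
    by (simp add: i cong_def)
  have evi: "ev j = ev (int i)"
    by (rule ev_cong[OF c])
  have roti: "rot n (- j * x) = rot n (- int i * x)" for x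
    by (intro rot_cong[OF pos] cong_scalar_right) (simp add: c cong_minus_minus_iff)
  have "(\<Sum>v<n. transition_mat n E t $$ (v, a) * rot n (- j * (int v - int a)))
    = (\<Sum>v<n. (\<Sum>l<n. cis (- t * ev (int l)) * rot n (int l * (int v - int a))) / of_nat n
         * rot n (- int i * (int v - int a)))"
    using a by (intro sum.cong refl) (simp only: transition_entry roti lessThan_iff)
  also have "\<dots> = (\<Sum>v<n. \<Sum>l<n. cis (- t * ev (int l)) *
      (rot n (- (int l - int i) * int a) * rot n (int v * (int l - int i)))) / of_nat n"
    unfolding sum_divide_distrib sum_distrib_right
    by (intro sum.cong refl) (simp add: mult.assoc rot_add[symmetric] algebra_simps)
  also have "\<dots> = (\<Sum>l<n. cis (- t * ev (int l)) * rot n (- (int l - int i) * int a)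
      * (\<Sum>v<n. rot n (int v * (int l - int i)))) / of_nat n"
    by (subst sum.swap) (simp only: sum_distrib_left mult.assoc)
  also have "\<dots> = (\<Sum>l<n. if l = i then cis (- t * ev (int i)) * of_nat n else 0) / of_nat n"
  proof (intro arg_cong2[where f = "(/)"] sum.cong refl)
    fix l assume "l \<in> {..<n}"
    then have "int n dvd int l - int i \<longleftrightarrow> l = i"
      using i(1) dvd_diff_vertices by simp
    then show "cis (- t * ev (int l)) * rot n (- (int l - int i) * int a)
        * (\<Sum>v<n. rot n (int v * (int l - int i)))
      = (if l = i then cis (- t * ev (int i)) * of_nat n else 0)"
      by (simp add: sum_rot pos)
  qed
  also have "\<dots> = cis (- t * ev j)"
    using i pos by (simp add: evi)
  finally show ?thesis by simp
qed

section \<open>Fractional revival expressed by limits of phases\<close>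

lemma rot_half_period:
  assumes "rot n (2 * x) = 1" "rot n x \<noteq> 1"
  shows "rot n (j * x) = (if even j then 1 else - 1)"
proof -
  have "(rot n x)\<^sup>2 = 1"
    using assms(1) rot_add[of n x x] by (simp add: power2_eq_square)
  then have m: "rot n x = - 1"
    using assms(2) by (simp add: power2_eq_1_iff)
  have e: "rot n (2 * i * x) = 1" for i
  proof -
    have "int n dvd i * (2 * x)"
      using assms(1) pos by (simp add: rot_eq_1_iff)
    then show ?thesis
      using pos by (simp add: rot_eq_1_iff mult_ac)
  qed
  show ?thesis
  proof (cases "even j")
    case True
    then show ?thesis using e[of "j div 2"] by simp
  next
    case False
    then obtain i where "j = 2 * i + 1" by (elim oddE)
    then show ?thesis
      using e[of i] m rot_add[of n "2 * i * x" x] by (simp add: algebra_simps)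
  qed
qed

text \<open>By \<open>fourier_inversion\<close>, entrywise convergence of column \<open>a\<close>
  becomes convergence of every phase to \<open>\<alpha> + \<beta> * rot n (- j * d)\<close> with
  \<open>d = b - a\<close>, and this depends only on the parity of \<open>j\<close> once
  \<open>2 * d\<close> is known to vanish modulo \<open>n\<close>.\<close>

lemma pgfr_imp_convergence:
  assumes "admits_pgfr n E"
  shows "even n \<and> (\<exists>t \<gamma>0 \<gamma>1. \<gamma>0 \<noteq> \<gamma>1 \<and>
    (\<forall>j. (\<lambda>k. cis (- t k * ev j)) \<longlonglongrightarrow> (if even j then \<gamma>0 else \<gamma>1)))"
proof -
  from assms obtain a b t \<alpha> \<beta> where ab: "a < n" "b < n" "b \<noteq> a" and \<beta>: "\<beta> \<noteq> 0"
    and lim: "\<And>v. v < n \<Longrightarrow> (\<lambda>k. (transition_mat n E (t k) *\<^sub>v unit_vec n a) $ v)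
           \<longlonglongrightarrow> (\<alpha> \<cdot>\<^sub>v unit_vec n a + \<beta> \<cdot>\<^sub>v unit_vec n b) $ v"
    unfolding admits_pgfr_def pgfr_from_to_def by blast
  define d where "d = int b - int a"
  have conv: "(\<lambda>k. cis (- t k * ev j)) \<longlonglongrightarrow> \<alpha> + \<beta> * rot n (- j * d)" for j
  proof -
    have "(\<lambda>k. transition_mat n E (t k) $$ (v, a)) \<longlonglongrightarrow> (if v = a then \<alpha> else 0) + (if v = b then \<beta> else 0)"
      if "v < n" for v
      using lim[OF that] that ab unfolding transition_vec[OF ab(1) that] by (auto simp: unit_vec_def)
    then have "(\<lambda>k. \<Sum>v<n. transition_mat n E (t k) $$ (v, a) * rot n (- j * (int v - int a)))
      \<longlonglongrightarrow> (\<Sum>v<n. ((if v = a then \<alpha> else 0) + (if v = b then \<beta> else 0)) * rot n (- j * (int v - int a)))"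
      by (intro tendsto_sum tendsto_mult tendsto_const) simp
    moreover have "(\<Sum>v<n. ((if v = a then \<alpha> else 0) + (if v = b then \<beta> else 0)) * rot n (- j * (int v - int a)))
      = (\<Sum>v<n. if v = a then \<alpha> * rot n (- j * (int v - int a)) else 0)
        + (\<Sum>v<n. if v = b then \<beta> * rot n (- j * (int v - int a)) else 0)"
      unfolding sum.distrib[symmetric] by (intro sum.cong) auto
    moreover have "\<dots> = \<alpha> + \<beta> * rot n (- j * d)"
      using ab by (simp add: d_def)
    ultimately show ?thesis
      using fourier_inversion[OF ab(1)] by simp
  qed
  \<comment> \<open>Indices \<open>1\<close> and \<open>-1\<close> share an eigenvalue, hence a
    limit; as \<beta> is nonzero, \<open>d\<close> and \<open>- d\<close> agree modulo
    \<open>n\<close>.\<close>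
  have "\<alpha> + \<beta> * rot n (- 1 * d) = \<alpha> + \<beta> * rot n (- (- 1) * d)"
    using conv[of 1] conv[of "- 1"] ev_minus[of 1] LIMSEQ_unique by metis
  then have "rot n (- d) = rot n d"
    using \<beta> by simp
  then have r2: "rot n (2 * d) = 1"
    using rot_add[of n d d] rot_add[of n d "- d"] by simp
  have nd: "\<not> int n dvd d"
    using ab dvd_diff_vertices by (simp add: d_def)
  then have r1: "rot n d \<noteq> 1"
    using pos by (simp add: rot_eq_1_iff)
  have "even n"
  proof (rule ccontr)
    assume "odd n"
    then have "coprime (int n) 2"
      by simp
    moreover have "int n dvd 2 * d"
      using r2 pos by (simp add: rot_eq_1_iff)
    ultimately show False
      using nd coprime_dvd_mult_right_iff by blast
  qed
  moreover have "(\<lambda>k. cis (- t k * ev j)) \<longlonglongrightarrow> (if even j then \<alpha> + \<beta> else \<alpha> - \<beta>)" for j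
    using conv[of j] rot_half_period[OF r2 r1, of "- j"] by (simp split: if_splits)
  moreover have "\<alpha> + \<beta> \<noteq> \<alpha> - \<beta>"
    using \<beta> by simp
  ultimately show ?thesis by blast
qed

lemma convergence_imp_pgfr:
  assumes "even n" and \<gamma>: "\<gamma>0 \<noteq> \<gamma>1"
    and conv: "\<And>j. (\<lambda>k. cis (- t k * ev j)) \<longlonglongrightarrow> (if even j then \<gamma>0 else \<gamma>1)"
  shows "admits_pgfr n E"
proof -
  define h where "h = n div 2"
  have h: "n = 2 * h" "h > 0"
    using assms(1) pos by (auto simp: h_def)
  \<comment> \<open>Solves \<open>\<alpha> + \<beta> = \<gamma>0\<close> and
    \<open>\<alpha> - \<beta> = \<gamma>1\<close>. The revival takes place between \<open>0\<close>
    and the antipodal vertex \<open>h\<close>.\<close>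
  define \<alpha> where "\<alpha> = (\<gamma>0 + \<gamma>1) / 2"
  define \<beta> where "\<beta> = (\<gamma>0 - \<gamma>1) / 2"
  have nrm: "norm (if even j then \<gamma>0 else \<gamma>1) = 1" for j :: int
    using tendsto_norm[OF conv[of j]] by (simp add: LIMSEQ_const_iff)
  have "norm \<gamma>0 = 1" "norm \<gamma>1 = 1"
    using nrm[of 0] nrm[of 1] by simp_all
  \<comment> \<open>Parallelogram identity for the two limits, which have modulus 1 as limits of
    phases.\<close>
  then have nab: "(cmod \<alpha>)\<^sup>2 + (cmod \<beta>)\<^sup>2 = 1"
    unfolding \<alpha>_def \<beta>_def
    by (simp add: cmod_def power_divide real_sqrt_eq_1_iff) (simp add: power2_eq_square field_simps)
  have par: "(if even j then \<gamma>0 else \<gamma>1) = \<alpha> + \<beta> * rot n (j * int h)" for j :: int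
  proof -
    have "rot n (2 * int h) = 1" "rot n (int h) \<noteq> 1"
      using h by (simp_all add: rot_eq_1_iff zdvd_not_zless)
    then show ?thesis
      by (simp add: rot_half_period \<alpha>_def \<beta>_def field_simps)
  qed
  have lim: "(\<lambda>k. (transition_mat n E (t k) *\<^sub>v unit_vec n 0) $ v)
           \<longlonglongrightarrow> (\<alpha> \<cdot>\<^sub>v unit_vec n 0 + \<beta> \<cdot>\<^sub>v unit_vec n h) $ v" if v: "v < n" for v
  proof -
    have "(\<lambda>k. (\<Sum>j<n. cis (- t k * ev (int j)) * rot n (int j * (int v - int 0))) / of_nat n)
      \<longlonglongrightarrow> (\<Sum>j<n. (\<alpha> + \<beta> * rot n (int j * int h)) * rot n (int j * (int v - int 0))) / of_nat n"
      using conv pos unfolding par by (intro tendsto_divide tendsto_sum tendsto_mult tendsto_const) auto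
    moreover have "(\<Sum>j<n. (\<alpha> + \<beta> * rot n (int j * int h)) * rot n (int j * (int v - int 0)))
      = \<alpha> * (\<Sum>j<n. rot n (int j * int v)) + \<beta> * (\<Sum>j<n. rot n (int j * (int h + int v)))"
      unfolding sum_distrib_left sum.distrib[symmetric]
      by (intro sum.cong) (simp_all add: algebra_simps rot_add)
    moreover have "int n dvd int v \<longleftrightarrow> v = 0"
      using v pos by (auto dest: zdvd_imp_le)
    moreover have "int n dvd int h + int v \<longleftrightarrow> v = h"
    proof
      assume "int n dvd int h + int v"
      then obtain c where c: "int h + int v = int n * c" ..
      then have "int n * 0 < int n * c" "int n * c < int n * 2"
        unfolding c[symmetric] using v h by simp_all
      then have "c = 1"
        using pos by (simp only: mult_less_cancel_left_pos of_nat_0_less_iff)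
      with c h show "v = h" by simp
    qed (use h in auto)
    moreover have "(\<alpha> \<cdot>\<^sub>v unit_vec n 0 + \<beta> \<cdot>\<^sub>v unit_vec n h) $ v
      = (\<alpha> * (if v = 0 then of_nat n else 0) + \<beta> * (if v = h then of_nat n else 0)) / of_nat n"
      using v h by (simp add: unit_vec_def)
    ultimately show ?thesis
      unfolding transition_vec[OF pos v] transition_entry[OF v pos] by (simp add: sum_rot pos)
  qed
  have "pgfr_from_to n E 0 h"
    unfolding pgfr_from_to_def using h nab lim \<gamma>
    by (intro conjI exI[of _ t] exI[of _ \<alpha>] exI[of _ \<beta>]) (auto simp: \<beta>_def)
  then show ?thesis
    unfolding admits_pgfr_def by blast
qed

end

section \<open>Orders without fractional revival\<close>

lemma prod_cis: "finite A \<Longrightarrow> (\<Prod>x\<in>A. cis (f x)) = cis (\<Sum>x\<in>A. f x)"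
  by (induction A rule: finite_induct) (simp_all add: cis_mult)

context circulant
begin

text \<open>For each fixed \<open>s\<close> the sum over \<open>k\<close> is a complete character
  sum modulo \<open>p\<close>, which vanishes because \<open>p\<close> does not divide
  \<open>s\<close>.\<close>

lemma sum_ev_coset:
  assumes p: "p > 0" "n = m * p" and ndvd: "\<And>s. s \<in> S \<Longrightarrow> \<not> int p dvd s"
  shows "(\<Sum>k<p. ev (x + int k * int m)) = 0"
proof -
  have m: "m > 0" using pos p by simp
  have "complex_of_real (\<Sum>k<p. ev (x + int k * int m))
    = (\<Sum>k<p. \<Sum>s\<in>S. rot n (x * s) * rot p (int k * s))"
    unfolding of_real_sum ev_rot
  proof (intro sum.cong refl)
    fix k s
    have "rot p (int k * s) = rot n (int k * int m * s)"
      using rot_cancel[OF m, of p "int k * s"] by (simp add: p mult_ac)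
    then show "rot n ((x + int k * int m) * s) = rot n (x * s) * rot p (int k * s)"
      by (simp add: distrib_right rot_add)
  qed
  also have "\<dots> = (\<Sum>s\<in>S. rot n (x * s) * (\<Sum>k<p. rot p (int k * s)))"
    by (subst sum.swap) (simp only: sum_distrib_left)
  also have "\<dots> = 0"
    using ndvd p by (intro sum.neutral) (simp add: sum_rot)
  finally show ?thesis
    by (simp only: of_real_eq_0_iff)
qed

text \<open>The step \<open>m\<close> is even, so all \<open>p\<close> indices in
  \<open>sum_ev_coset\<close> have the parity of \<open>j\<close>. The product of their phases tends
  to the \<open>p\<close>-th power of the limit, but is constantly 1 because the eigenvalues add up
  to zero.\<close>

lemma limit_power_eq_1:
  fixes j :: int
  assumes p: "p > 0" "n = m * p" "even m" and ndvd: "\<And>s. s \<in> S \<Longrightarrow> \<not> int p dvd s"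
    and conv: "\<And>j. (\<lambda>k. cis (- t k * ev j)) \<longlonglongrightarrow> (if even j then \<gamma>0 else \<gamma>1)"
  shows "(if even j then \<gamma>0 else \<gamma>1) ^ p = 1"
proof -
  let ?\<gamma> = "if even j then \<gamma>0 else \<gamma>1"
  have "(\<lambda>k. \<Prod>i<p. cis (- t k * ev (j + int i * int m))) \<longlonglongrightarrow> (\<Prod>i<p. ?\<gamma>)"
  proof (rule tendsto_prod)
    fix i
    have "even (j + int i * int m) \<longleftrightarrow> even j"
      using p by simp
    then show "(\<lambda>k. cis (- t k * ev (j + int i * int m))) \<longlonglongrightarrow> ?\<gamma>"
      using conv[of "j + int i * int m"] by simp
  qed
  moreover have "(\<Prod>i<p. cis (- t k * ev (j + int i * int m))) = 1" for k
    using sum_ev_coset[OF p(1,2) ndvd, of j]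
    by (simp only: prod_cis finite_lessThan sum_distrib_left[symmetric] mult_zero_right cis_zero)
  ultimately show ?thesis
    by (simp add: LIMSEQ_const_iff)
qed

text \<open>Translation by \<open>d\<close> permutes \<open>S\<close>, so it leaves the character
  sum unchanged while multiplying it by \<open>rot n (j * d)\<close>, which differs from 1.\<close>

lemma ev_eq_0_if_shift_invariant:
  assumes shift: "\<And>s. s \<in> S \<Longrightarrow> (s + d) mod int n \<in> S" and j: "\<not> int n dvd j * d"
  shows "ev j = 0"
proof -
  let ?f = "\<lambda>s. (s + d) mod int n"
  have inj: "inj_on ?f S"
  proof (rule inj_onI)
    fix s s' assume s: "s \<in> S" "s' \<in> S" and "?f s = ?f s'"
    then have "int n dvd (s + d) - (s' + d)"
      by (simp only: mod_eq_dvd_iff)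
    then have "s mod int n = s' mod int n"
      by (simp add: mod_eq_dvd_iff)
    then show "s = s'"
      by (simp only: mod_S s)
  qed
  have img: "?f ` S = S"
    using shift by (intro endo_inj_surj finite_S inj) auto
  have "(\<Sum>s\<in>S. rot n (j * s)) = (\<Sum>s\<in>?f ` S. rot n (j * s))"
    by (simp only: img)
  also have "\<dots> = (\<Sum>s\<in>S. rot n (j * ?f s))"
    by (simp add: sum.reindex[OF inj])
  also have "\<dots> = (\<Sum>s\<in>S. rot n (j * d) * rot n (j * s))"
  proof (intro sum.cong refl)
    fix s
    have "rot n (j * ?f s) = rot n (j * (s + d))"
      by (intro rot_cong[OF pos] cong_scalar_left) (simp add: cong_def)
    then show "rot n (j * ?f s) = rot n (j * d) * rot n (j * s)"
      by (simp add: distrib_left rot_add)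
  qed
  finally have "complex_of_real (ev j) = rot n (j * d) * ev j"
    unfolding ev_rot by (simp only: sum_distrib_left[symmetric])
  moreover have "rot n (j * d) \<noteq> 1"
    using j pos by (simp add: rot_eq_1_iff)
  ultimately show ?thesis by simp
qed

end

section \<open>The connection set of the quadratic unitary Cayley graph\<close>

definition quc_set :: "nat \<Rightarrow> int set" where
  "quc_set n = {s. 0 \<le> s \<and> s < int n \<and>
    (\<exists>u. coprime u (int n) \<and> ([s = u\<^sup>2] (mod int n) \<or> [s = - u\<^sup>2] (mod int n)))}"

lemma coprime_quc_set:
  assumes "s \<in> quc_set n"
  shows "coprime s (int n)"
proof -
  obtain u where u: "coprime u (int n)" "[s = u\<^sup>2] (mod int n) \<or> [s = - u\<^sup>2] (mod int n)"
    using assms by (auto simp: quc_set_def)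
  have "coprime (u\<^sup>2) (int n)" "coprime (- u\<^sup>2) (int n)"
    using u by simp_all
  then show ?thesis
    using u(2) cong_imp_coprime cong_sym by blast
qed

lemma not_dvd_quc_set:
  assumes "s \<in> quc_set n" "p dvd n" "p > 1"
  shows "\<not> int p dvd s"
proof
  assume "int p dvd s"
  moreover have "int p dvd int n" using assms by simp
  ultimately have "is_unit (int p)"
    using coprime_quc_set[OF assms(1)] coprime_common_divisor by blast
  with assms show False by simp
qed

lemma mod_in_quc_set:
  assumes "n > 0"
  shows "s mod int n \<in> quc_set n \<longleftrightarrow>
    (\<exists>u. coprime u (int n) \<and> ([s = u\<^sup>2] (mod int n) \<or> [s = - u\<^sup>2] (mod int n)))"
  using assms by (simp add: quc_set_def cong_def)

lemma circulant_quc: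
  assumes n: "n \<ge> 2"
  shows "circulant n (quc_set n) (quc_adj n)"
proof
  show "n > 0" using n by simp
  show "quc_set n \<subseteq> {0..<int n}" by (auto simp: quc_set_def)
next
  fix s assume "s \<in> quc_set n"
  then obtain u where u: "coprime u (int n)" "[s = u\<^sup>2] (mod int n) \<or> [s = - u\<^sup>2] (mod int n)"
    by (auto simp: quc_set_def)
  then have "[- s = u\<^sup>2] (mod int n) \<or> [- s = - u\<^sup>2] (mod int n)"
    using cong_minus_minus_iff[of s "u\<^sup>2"] cong_minus_minus_iff[of s "- u\<^sup>2"] by auto
  then show "- s mod int n \<in> quc_set n"
    using u n by (subst mod_in_quc_set) auto
next
  fix i j :: nat
  show "quc_adj n i j \<longleftrightarrow> i < n \<and> j < n \<and> (int i - int j) mod int n \<in> quc_set n" (is "_ \<longleftrightarrow> ?R")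
  proof
    assume "quc_adj n i j"
    then show ?R
      using n unfolding quc_adj_def by (subst mod_in_quc_set) (auto simp: coprime_iff_gcd_eq_1)
  next
    assume R: ?R
    then obtain u where u: "coprime u (int n)"
      "[int i - int j = u\<^sup>2] (mod int n) \<or> [int i - int j = - u\<^sup>2] (mod int n)"
      using n by (subst (asm) mod_in_quc_set) auto
    have "i \<noteq> j"
    proof
      assume "i = j"
      then have "0 \<in> quc_set n" using R by simp
      then have "coprime 0 (int n)" by (rule coprime_quc_set)
      with n show False by simp
    qed
    \<comment> \<open>\<open>quc_set\<close> allows any integer root coprime to \<open>n\<close>;
      \<open>quc_adj\<close> asks for one between \<open>1\<close> and \<open>n - 1\<close>.\<close>
    define v where "v = u mod int n"
    have v: "coprime v (int n)"
      using u n by (simp add: v_def)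
    have "[v\<^sup>2 = u\<^sup>2] (mod int n)"
      by (rule cong_pow) (simp add: v_def cong_def)
    then have "[int i - int j = v\<^sup>2] (mod int n) \<or> [int i - int j = - v\<^sup>2] (mod int n)"
      using u(2) cong_minus_minus_iff[of "v\<^sup>2" "u\<^sup>2"] by (meson cong_sym cong_trans)
    moreover have "v \<noteq> 0"
      using v n by auto
    then have "1 \<le> v" "v \<le> int n - 1"
      using n pos_mod_sign[of "int n" u] pos_mod_bound[of "int n" u] unfolding v_def by linarith+
    ultimately show "quc_adj n i j"
      unfolding quc_adj_def using R v \<open>i \<noteq> j\<close> by (auto simp: coprime_iff_gcd_eq_1)
  qed
qed

text \<open>The factor \<open>e\<close> serves both signs: \<open>e = 1\<close> handles
  \<open>u\<^sup>2 + d\<close>, and \<open>e = - 1\<close> handles \<open>- u\<^sup>2 + d\<close>,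
  the negative of \<open>u\<^sup>2 - d\<close>.\<close>

lemma quc_set_shift:
  assumes n: "n > 0" and s: "s \<in> quc_set n"
    and sq: "\<And>u e. coprime u (int n) \<Longrightarrow> \<exists>v. coprime v (int n) \<and> [v\<^sup>2 = u\<^sup>2 + e * d] (mod int n)"
  shows "(s + d) mod int n \<in> quc_set n"
proof -
  obtain u where u: "coprime u (int n)" "[s = u\<^sup>2] (mod int n) \<or> [s = - u\<^sup>2] (mod int n)"
    using s by (auto simp: quc_set_def)
  from u(2) show ?thesis
  proof
    assume c: "[s = u\<^sup>2] (mod int n)"
    obtain v where v: "coprime v (int n)" "[v\<^sup>2 = u\<^sup>2 + 1 * d] (mod int n)"
      using sq[OF u(1)] by blast
    have "[s + d = v\<^sup>2] (mod int n)"
      using cong_trans[OF cong_add[OF c cong_refl[of d]], of "v\<^sup>2"] cong_sym[OF v(2)] by simp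
    then show ?thesis
      using v(1) n by (subst mod_in_quc_set) auto
  next
    assume c: "[s = - u\<^sup>2] (mod int n)"
    obtain v where v: "coprime v (int n)" "[v\<^sup>2 = u\<^sup>2 + (- 1) * d] (mod int n)"
      using sq[OF u(1)] by blast
    have "[- v\<^sup>2 = - u\<^sup>2 + d] (mod int n)"
      using cong_minus_minus_iff[of "v\<^sup>2" "u\<^sup>2 + (- 1) * d" "int n"] v(2) by simp
    then have "[s + d = - v\<^sup>2] (mod int n)"
      using cong_trans[OF cong_add[OF c cong_refl[of d]], of "- v\<^sup>2"] cong_sym by blast
    then show ?thesis
      using v(1) n by (subst mod_in_quc_set) auto
  qed
qed

section \<open>Lifting square roots of units\<close>

lemma coprime_add_multiple:
  fixes a d m :: int
  assumes "coprime a m" "m dvd d"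
  shows "coprime (a + d) m"
  using assms cong_imp_coprime[of a "a + d" m] by (simp add: cong_iff_dvd_diff)

text \<open>Hensel lifting with \<open>v = u + c * m\<close>: the term
  \<open>(c * m)\<^sup>2\<close> vanishes modulo \<open>m * p\<close> since \<open>p\<close> divides
  \<open>m\<close>, which leaves the congruence \<open>2 * u * c = e\<close> modulo
  \<open>p\<close>, solvable as \<open>2 * u\<close> is a unit.\<close>

lemma square_shift_odd:
  fixes u e :: int
  assumes p: "prime p" "odd p" "p dvd m" and u: "coprime u (int (m * p))"
  shows "\<exists>v. coprime v (int (m * p)) \<and> [v\<^sup>2 = u\<^sup>2 + e * int m] (mod int (m * p))"
proof -
  have um: "coprime u (int m)" and "coprime u (int p)"
    using u by simp_all
  then have "coprime (2 * u) (int p)"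
    using p by simp
  then obtain c' where c': "[2 * u * c' = 1] (mod int p)"
    using cong_solve_coprime_int by blast
  define c where "c = c' * e"
  have c: "[2 * u * c = e] (mod int p)"
    using cong_scalar_right[OF c', of e] by (simp add: c_def mult.assoc)
  define v where "v = u + c * int m"
  have "coprime v (int m)"
    using coprime_add_multiple[OF um, of "c * int m"] by (simp add: v_def)
  moreover have "int p dvd int m" using p by simp
  ultimately have "coprime v (int p)"
    using coprime_divisors[OF dvd_refl, of "int p" "int m" v] by simp
  with \<open>coprime v (int m)\<close> have "coprime v (int (m * p))"
    by simp
  moreover have "int (m * p) dvd v\<^sup>2 - (u\<^sup>2 + e * int m)"
  proof -
    have "int p dvd 2 * u * c - e + c\<^sup>2 * int m"
      using c p by (simp add: cong_iff_dvd_diff)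
    then have "int m * int p dvd int m * (2 * u * c - e + c\<^sup>2 * int m)"
      by (rule mult_dvd_mono[OF dvd_refl])
    then show ?thesis
      by (simp add: v_def power2_eq_square algebra_simps)
  qed
  ultimately show ?thesis
    by (auto simp: cong_iff_dvd_diff)
qed

text \<open>Here 2 is not invertible, so the root moves by half of \<open>m\<close>: with
  \<open>m = 8 * l\<close> and \<open>v = u + 4 * e * l\<close>, the cross term is
  \<open>e * m * u\<close>, congruent to \<open>e * m\<close> modulo \<open>2 * m\<close> because
  \<open>u\<close> is odd, and the square term is a multiple of \<open>2 * m\<close>.\<close>

lemma square_shift_even:
  fixes u e :: int
  assumes m: "8 dvd m" and u: "coprime u (int (m * 2))"
  shows "\<exists>v. coprime v (int (m * 2)) \<and> [v\<^sup>2 = u\<^sup>2 + e * int m] (mod int (m * 2))"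
proof -
  obtain l where l: "m = 8 * l" using m ..
  have um: "coprime u (int m)" and "odd u"
    using u by simp_all
  define v where "v = u + e * (4 * int l)"
  have "odd v" using \<open>odd u\<close> by (simp add: v_def)
  have "coprime u (int l)"
    using um by (simp add: l)
  then have "coprime v (int l)"
    using coprime_add_multiple[of u "int l" "e * (4 * int l)"] by (simp add: v_def)
  moreover have "coprime v 2"
    using \<open>odd v\<close> by simp
  then have "coprime v (2 ^ 4)"
    by (simp only: coprime_power_right_iff) simp
  ultimately have "coprime v (2 ^ 4 * int l)"
    by (simp only: coprime_mult_right_iff)
  then have "coprime v (int (m * 2))"
    by (simp add: l)
  moreover have "int (m * 2) dvd v\<^sup>2 - (u\<^sup>2 + e * int m)"
  proof -
    obtain w where "u = 2 * w + 1" using \<open>odd u\<close> by (elim oddE)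
    then have "v\<^sup>2 - (u\<^sup>2 + e * int m) = int (m * 2) * (e * w + e\<^sup>2 * int l)"
      by (simp add: v_def l power2_eq_square algebra_simps)
    then show ?thesis by simp
  qed
  ultimately show ?thesis
    by (auto simp: cong_iff_dvd_diff)
qed

text \<open>Prime factors of \<open>n / 2\<close> are split off one at a time. A second factor must
  equal the first by \<open>uniq\<close>, and then be 2 by \<open>sqfree\<close>; a third one would
  make 16 a divisor of \<open>n\<close>.\<close>

lemma even_nat_double_primeI:
  fixes n :: nat
  assumes "n > 0" "even n"
    and uniq: "\<And>p q. prime p \<Longrightarrow> prime q \<Longrightarrow> 2 * p dvd n \<Longrightarrow> 2 * q dvd n \<Longrightarrow> p = q"
    and sqfree: "\<And>p. prime p \<Longrightarrow> odd p \<Longrightarrow> \<not> 2 * p * p dvd n" and "\<not> 16 dvd n"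
  shows "n \<in> {2, 8} \<union> {2 * p | p :: nat. prime p}"
proof (rule ccontr)
  assume no: "\<not> ?thesis"
  obtain m where m: "n = 2 * m" using assms(2) ..
  have "m \<noteq> 1" using no m by auto
  then obtain p where p: "prime p" "p dvd m" using prime_factor_nat by blast
  then obtain l where l: "m = p * l" by blast
  have "l \<noteq> 1" using no m l p by auto
  then obtain q where q: "prime q" "q dvd l" using prime_factor_nat by blast
  have "q = p"
    using q p by (intro uniq) (auto simp: m l)
  with q l m sqfree[OF p(1)] have "even p" by auto
  with p have p2: "p = 2" using prime_nat_iff two_is_prime_nat primes_dvd_imp_eq by blast
  obtain r where r: "l = 2 * r" using q \<open>q = p\<close> p2 by blast
  have "r \<noteq> 1" using no m l r p2 by auto
  then obtain q' where q': "prime q'" "q' dvd r" using prime_factor_nat by blast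
  have "q' = p"
    using q' p by (intro uniq) (auto simp: m l r)
  with q' p2 obtain r' where "r = 2 * r'" by blast
  with assms(5) show False by (simp add: m l r p2)
qed

lemma pgfr_quc_imp:
  assumes "n > 0" "admits_pgfr n (quc_adj n)"
  shows "n \<in> {2, 8} \<union> {2 * p | p :: nat. prime p}"
proof -
  have n: "n \<ge> 2"
    using assms by (auto simp: admits_pgfr_def pgfr_from_to_def)
  interpret circulant n "quc_set n" "quc_adj n"
    by (rule circulant_quc[OF n])
  obtain t \<gamma>0 \<gamma>1 where "even n" and \<gamma>: "\<gamma>0 \<noteq> \<gamma>1"
    and conv: "\<And>j. (\<lambda>k. cis (- t k * ev j)) \<longlonglongrightarrow> (if even j then \<gamma>0 else \<gamma>1)"
    using pgfr_imp_convergence[OF assms(2)] by blast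
  have zero: "(if even j then \<gamma>0 else \<gamma>1) = 1" if "ev j = 0" for j
    using conv[of j] that by (simp add: LIMSEQ_const_iff)
  have pow: "\<gamma>0 ^ p = 1 \<and> \<gamma>1 ^ p = 1" if p: "prime p" "2 * p dvd n" for p
  proof -
    obtain l where "n = 2 * p * l" using p(2) ..
    \<comment> \<open>This grouping makes the step \<open>2 * l\<close> even, as
      \<open>limit_power_eq_1\<close> demands.\<close>
    then have l: "n = (2 * l) * p" by simp
    have "\<not> int p dvd s" if "s \<in> quc_set n" for s
      using not_dvd_quc_set[OF that, of p] l prime_gt_1_nat[OF p(1)] by simp
    then show ?thesis
      using limit_power_eq_1[OF _ l _ _ conv, of 0] limit_power_eq_1[OF _ l _ _ conv, of 1]
        prime_gt_0_nat[OF p(1)] by simp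
  qed
  show ?thesis
  proof (rule even_nat_double_primeI[OF assms(1) \<open>even n\<close>])
    fix p q :: nat assume p: "prime p" "2 * p dvd n" and q: "prime q" "2 * q dvd n"
    show "p = q"
    proof (rule ccontr)
      assume "p \<noteq> q"
      then have "coprime p q"
        using p q primes_coprime by blast
      \<comment> \<open>With this Bezout relation, a number whose \<open>p\<close>-th and
        \<open>q\<close>-th powers are 1 is itself 1.\<close>
      then obtain a b where ab: "a * p = b * q + 1"
        using p(1) coprime_bezout_strong[of p q] prime_gt_1_nat[OF q(1)] by (auto simp: mult_ac)
      have "\<gamma> = 1" if "\<gamma> ^ p = 1" "\<gamma> ^ q = 1" for \<gamma> :: complex
      proof -
        have "\<gamma> ^ (a * p) = 1" "\<gamma> ^ (b * q) = 1"
          using that by (metis mult.commute power_mult power_one)+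
        then show ?thesis by (simp add: ab)
      qed
      then show False
        using pow[OF p] pow[OF q] \<gamma> by blast
    qed
  next
    fix p :: nat assume p: "prime p" "odd p"
    show "\<not> 2 * p * p dvd n"
    proof
      assume "2 * p * p dvd n"
      then obtain l where "n = 2 * p * p * l" ..
      then have l: "n = (2 * p * l) * p" by simp
      let ?m = "2 * p * l"
      have "p > 2" using p primes_dvd_imp_eq prime_gt_1_nat[of p] by (cases "p = 2") auto
      have shift: "(s + int ?m) mod int n \<in> quc_set n" if "s \<in> quc_set n" for s
        using square_shift_odd[OF p, of ?m] by (intro quc_set_shift[OF pos that]) (simp add: l)
      have ndvd: "\<not> int n dvd j * int ?m" if "0 < j" "j < int p" for j
      proof
        assume "int n dvd j * int ?m"
        then have "int p dvd j"
          using pos by (simp add: l)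
        with that show False by (simp add: zdvd_not_zless)
      qed
      \<comment> \<open>One index of each parity; neither is divisible by \<open>p\<close>, since
        \<open>p > 2\<close>.\<close>
      have "ev 1 = 0" "ev 2 = 0"
        using \<open>p > 2\<close> ndvd[of 1] ndvd[of 2] by (intro ev_eq_0_if_shift_invariant[OF shift]; simp)+
      then show False
        using zero[of 1] zero[of 2] \<gamma> by simp
    qed
  next
    show "\<not> 16 dvd n"
    proof
      assume "16 dvd n"
      then obtain l where l: "n = 16 * l" ..
      let ?m = "8 * l"
      have shift: "(s + int ?m) mod int n \<in> quc_set n" if "s \<in> quc_set n" for s
        using square_shift_even[of ?m] by (intro quc_set_shift[OF pos that]) (simp add: l)
      have "ev 1 = 0"
        using pos by (intro ev_eq_0_if_shift_invariant[OF shift]) (auto simp: l dest: zdvd_imp_le)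
      \<comment> \<open>Translation by \<open>n / 2\<close> says nothing about even indices. At the
        even index \<open>n / 4\<close> every angle is an odd multiple of \<open>pi / 2\<close>
        instead.\<close>
      moreover have "ev (4 * int l) = 0"
      proof -
        have "cos (2 * pi * real_of_int (4 * int l * s) / real n) = 0" if "s \<in> quc_set n" for s
        proof -
          have "odd s"
            using not_dvd_quc_set[OF that, of 2] l by simp
          then obtain i where "s = 2 * i + 1" by (elim oddE)
          then have "2 * pi * real_of_int (4 * int l * s) / real n = real_of_int (2 * i + 1) * (pi / 2)"
            using pos by (simp add: l field_simps)
          then show ?thesis
            unfolding cos_zero_iff_int by (intro exI[of _ "2 * i + 1"]) simp
        qed
        then show ?thesis
          unfolding ev_def by (intro sum.neutral) blast
      qed
      ultimately show False
        using zero[of 1] zero[of "4 * int l"] \<gamma> by simp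
    qed
  qed
qed

section \<open>Orders with fractional revival\<close>

lemma cis_approx:
  fixes \<theta> \<alpha> :: real
  assumes "\<theta> \<notin> \<rat>"
  obtains h :: "nat \<Rightarrow> int" where "(\<lambda>k. cis (2 * pi * (h k * \<theta> - \<alpha>))) \<longlonglongrightarrow> 1"
proof -
  \<comment> \<open>Density of the fractional parts of multiples of an irrational number; the
    integer \<open>g\<close> will disappear under \<open>cis\<close>.\<close>
  have "\<exists>h g :: int. \<bar>of_int h * \<theta> - of_int g - \<alpha>\<bar> < inverse (real (Suc k))" for k
    using sequence_of_fractional_parts_is_dense[OF assms, of "inverse (real (Suc k))" \<alpha>]
    by (metis inverse_positive_iff_positive of_nat_0_less_iff zero_less_Suc)
  then obtain h g where hg: "\<And>k. \<bar>of_int (h k) * \<theta> - of_int (g k) - \<alpha>\<bar> < inverse (real (Suc k))"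
    by metis
  have "(\<lambda>k. of_int (h k) * \<theta> - of_int (g k) - \<alpha>) \<longlonglongrightarrow> 0"
    by (rule Lim_null_comparison[OF always_eventually LIMSEQ_inverse_real_of_nat])
      (use hg in \<open>auto intro: less_imp_le\<close>)
  then have "(\<lambda>k. cis (2 * pi * (of_int (h k) * \<theta> - of_int (g k) - \<alpha>))) \<longlonglongrightarrow> cis (2 * pi * 0)"
    unfolding cis_conv_exp by (intro tendsto_intros)
  moreover have "cis (2 * pi * (of_int (h k) * \<theta> - of_int (g k) - \<alpha>)) = cis (2 * pi * (h k * \<theta> - \<alpha>))" for k
  proof -
    have "2 * pi * (of_int (h k) * \<theta> - of_int (g k) - \<alpha>)
      = 2 * pi * (h k * \<theta> - \<alpha>) - 2 * pi * of_int (g k)"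
      by (simp add: algebra_simps)
    then show ?thesis
      by (simp only: cis_divide[symmetric] cis_multiple_2pi[OF Ints_of_int] div_by_1)
  qed
  ultimately have "(\<lambda>k. cis (2 * pi * (h k * \<theta> - \<alpha>))) \<longlonglongrightarrow> 1"
    by simp
  then show thesis by (rule that)
qed

lemma sqrt_prime_irrational:
  assumes "prime (p::nat)"
  shows "sqrt (real p) \<notin> \<rat>"
proof
  assume "sqrt (real p) \<in> \<rat>"
  then obtain m n :: nat where mn: "n \<noteq> 0" "\<bar>sqrt (real p)\<bar> = real m / real n" "coprime m n"
    by (rule Rats_abs_nat_div_natE)
  then have "real p * (real n)\<^sup>2 = (real m)\<^sup>2"
    by (simp add: field_simps power2_eq_square) (metis mult.assoc mult.commute of_nat_0_le_iff real_sqrt_mult_self abs_of_nat)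
  then have eq: "p * n\<^sup>2 = m\<^sup>2"
    by (metis of_nat_eq_iff of_nat_mult of_nat_power)
  then have "p dvd m\<^sup>2" by (metis dvd_triv_left)
  then have "p dvd m" using assms prime_dvd_power by blast
  then obtain k where k: "m = p * k" ..
  have "p dvd n\<^sup>2"
    using eq assms by (simp add: k power2_eq_square mult_ac)
  then have "p dvd n" using assms prime_dvd_power by blast
  with \<open>p dvd m\<close> mn(3) have "is_unit p"
    using coprime_common_divisor by blast
  with assms show False
    by simp
qed

section \<open>Orders dividing 8\<close>

lemma odd_square_cong_1_mod_8:
  fixes u :: int
  assumes "odd u"
  shows "[u\<^sup>2 = 1] (mod 8)"
proof -
  obtain w where w: "u = 2 * w + 1" using assms by (elim oddE)
  have "even (w * (w + 1))" by simp
  then obtain v where "w * (w + 1) = 2 * v" ..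
  then have "u\<^sup>2 - 1 = 8 * v"
    by (simp add: w power2_eq_square algebra_simps)
  then show ?thesis
    by (simp add: cong_iff_dvd_diff)
qed

text \<open>Units modulo such \<open>n\<close> are odd, and odd squares are 1 modulo 8. So the graph
  is a single edge for \<open>n = 2\<close> and a cycle otherwise.\<close>

lemma quc_set_dvd_8:
  assumes "n dvd 8" "n \<ge> 2"
  shows "quc_set n = {1, int n - 1}"
proof (intro equalityI subsetI)
  fix s assume s: "s \<in> quc_set n"
  then obtain u where u: "coprime u (int n)" "[s = u\<^sup>2] (mod int n) \<or> [s = - u\<^sup>2] (mod int n)"
    by (auto simp: quc_set_def)
  have "n dvd 2 ^ 3" using assms by simp
  then obtain i where "n = 2 ^ i"
    using divides_primepow_nat[OF two_is_prime_nat] by blast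
  then have "even n"
    using assms(2) by (cases i) auto
  then have "odd u"
    using u(1) coprime_common_divisor[of u "int n" 2] by auto
  have n8: "int n dvd 8"
    using assms(1) by presburger
  have "[u\<^sup>2 = 1] (mod int n)"
    using cong_dvd_modulus[OF odd_square_cong_1_mod_8[OF \<open>odd u\<close>] n8] .
  then have "[s = 1] (mod int n) \<or> [s = - 1] (mod int n)"
    using u(2) cong_minus_minus_iff[of "u\<^sup>2" 1 "int n"] cong_trans by blast
  moreover have "[- 1 = int n - 1] (mod int n)"
    by (simp add: cong_iff_dvd_diff)
  ultimately have "[s = 1] (mod int n) \<or> [s = int n - 1] (mod int n)"
    using cong_trans by blast
  then show "s \<in> {1, int n - 1}"
    using s assms cong_less_imp_eq_int[of s "int n"] by (auto simp: quc_set_def)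
next
  fix s assume "s \<in> {1, int n - 1}"
  then have "0 \<le> s" "s < int n" and "[s = 1\<^sup>2] (mod int n) \<or> [s = - 1\<^sup>2] (mod int n)"
    using assms by (auto simp: cong_iff_dvd_diff)
  then show "s \<in> quc_set n"
    by (auto simp: quc_set_def intro!: exI[of _ 1])
qed

text \<open>The bound \<open>n \<ge> 3\<close> keeps the two connecting elements distinct.\<close>

lemma (in circulant) ev_cycle:
  assumes "S = {1, int n - 1}" "n \<ge> 3"
  shows "ev j = 2 * cos (2 * pi * real_of_int j / real n)"
proof -
  have "rot n (j * (int n - 1)) = rot n (- j)"
    by (rule rot_cong[OF pos]) (simp add: cong_iff_dvd_diff algebra_simps)
  then have "Re (rot n (j * (int n - 1))) = Re (rot n j)"
    by (simp add: rot_minus)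
  moreover have "ev j = (\<Sum>s\<in>{1, int n - 1}. Re (rot n (j * s)))"
    unfolding ev_def unfolding assms(1) Re_rot ..
  ultimately show ?thesis
    using assms(2) by (simp add: Re_rot)
qed

lemma pgfr_2: "admits_pgfr 2 (quc_adj 2)"
proof -
  interpret circulant 2 "quc_set 2" "quc_adj 2"
    by (rule circulant_quc) simp
  have ev: "ev j = (if even j then 1 else - 1)" for j
    unfolding ev_def by (simp add: quc_set_dvd_8 cos_npi_int)
  show ?thesis
    by (rule convergence_imp_pgfr[of "- \<i>" \<i> "\<lambda>_. pi / 2"])
      (simp_all add: ev flip: cis_cnj)
qed

text \<open>The eigenvalues are 2 and -2 at even indices and 0 at odd ones, so at time
  \<open>pi / 2\<close> the phases are exactly -1 and 1.\<close>

lemma pgfr_4: "admits_pgfr 4 (quc_adj 4)"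
proof -
  interpret circulant 4 "quc_set 4" "quc_adj 4"
    by (rule circulant_quc) simp
  have ev: "ev j = (if even j then if 4 dvd j then 2 else - 2 else 0)" for j
  proof -
    have "ev j = 2 * cos (pi * real_of_int j / 2)"
      using ev_cycle[of j] by (simp add: quc_set_dvd_8)
    moreover have "cos (pi * real_of_int j / 2) = (if even j then if 4 dvd j then 1 else - 1 else 0)"
    proof (cases "even j")
      case True
      then obtain i where "j = 2 * i" ..
      moreover from this have "4 dvd j \<longleftrightarrow> even i" by presburger
      ultimately show ?thesis by (simp add: cos_npi_int)
    next
      case False
      then show ?thesis
        by (auto simp: cos_zero_iff_int intro!: exI[of _ j])
    qed
    ultimately show ?thesis by simp
  qed
  show ?thesis
    by (rule convergence_imp_pgfr[of "- 1" 1 "\<lambda>_. pi / 2"])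
      (simp_all add: ev flip: cis_cnj)
qed

text \<open>Even indices have eigenvalues 2, -2 and 0, whose phases are 1 at every integer multiple
  of \<open>pi\<close>. Odd indices have \<open>sqrt 2\<close> and \<open>- sqrt 2\<close>, whose
  phases can be steered to -1 along such times.\<close>

lemma pgfr_8: "admits_pgfr 8 (quc_adj 8)"
proof -
  interpret circulant 8 "quc_set 8" "quc_adj 8"
    by (rule circulant_quc) simp
  have evc: "ev j = 2 * cos (pi * real_of_int j / 4)" for j
    using ev_cycle[of j] by (simp add: quc_set_dvd_8)
  have ev_even: "ev j \<in> {2, - 2, 0}" if "even j" for j
  proof -
    obtain i where i: "j = 2 * i" using \<open>even j\<close> ..
    show ?thesis
    proof (cases "even i")
      case True
      then obtain l where "i = 2 * l" ..
      then show ?thesis by (simp add: evc i cos_npi_int)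
    next
      case False
      then have "cos (pi * real_of_int i / 2) = 0"
        by (auto simp: cos_zero_iff_int intro!: exI[of _ i])
      then show ?thesis by (simp add: evc i)
    qed
  qed
  have ev_odd: "ev j \<in> {sqrt 2, - sqrt 2}" if "odd j" for j
  proof -
    have "cos (pi * real_of_int j / 2) = 0"
      using that by (auto simp: cos_zero_iff_int intro!: exI[of _ j])
    then have "(ev j)\<^sup>2 = 2"
      using cos_double_cos[of "pi * real_of_int j / 4"] by (simp add: evc power_mult_distrib)
    then have "(ev j)\<^sup>2 = (sqrt 2)\<^sup>2" by simp
    then show ?thesis
      unfolding power2_eq_iff by blast
  qed
  have "sqrt 2 / 2 \<notin> \<rat>"
  proof
    assume "sqrt 2 / 2 \<in> \<rat>"
    then have "sqrt 2 / 2 * 2 \<in> \<rat>" by (rule Rats_mult) simp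
    then show False using sqrt_prime_irrational[of 2] by simp
  qed
  \<comment> \<open>The offset \<open>1 / 2\<close> becomes the angle \<open>pi\<close>, that is,
    the limit -1 for \<open>cis (pi * h k * sqrt 2)\<close>.\<close>
  then obtain h :: "nat \<Rightarrow> int" where h: "(\<lambda>k. cis (2 * pi * (h k * (sqrt 2 / 2) - 1 / 2))) \<longlonglongrightarrow> 1"
    by (rule cis_approx)
  have "cis (2 * pi * (h k * (sqrt 2 / 2) - 1 / 2)) = - cis (pi * h k * sqrt 2)" for k
  proof -
    have "2 * pi * (h k * (sqrt 2 / 2) - 1 / 2) = pi * h k * sqrt 2 - pi"
      by (simp add: field_simps)
    then show ?thesis
      by (simp add: cis_divide[symmetric])
  qed
  then have h': "(\<lambda>k. cis (pi * h k * sqrt 2)) \<longlonglongrightarrow> - 1"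
    using tendsto_minus[OF h] by simp
  have h'': "(\<lambda>k. cis (- (pi * h k * sqrt 2))) \<longlonglongrightarrow> - 1"
    using tendsto_cnj[OF h'] by (simp add: cis_cnj)
  have per: "cis (- (pi * h k * x)) = 1" if "x \<in> {2, - 2, 0}" for k x
  proof -
    define i :: int where "i = (if x = 2 then 1 else if x = - 2 then - 1 else 0)"
    have "x = 2 * of_int i"
      using that by (auto simp: i_def)
    then have "- (pi * h k * x) = 2 * pi * of_int (- h k * i)"
      by simp
    then show ?thesis
      by (simp only: cis_multiple_2pi Ints_of_int)
  qed
  show ?thesis
  proof (rule convergence_imp_pgfr[of 1 "- 1" "\<lambda>k. pi * h k"])
    fix j
    show "(\<lambda>k. cis (- (pi * h k) * ev j)) \<longlonglongrightarrow> (if even j then 1 else - 1)"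
      using per[OF ev_even, of j] ev_odd[of j] h' h'' by (cases "even j") auto
  qed simp_all
qed

section \<open>The Legendre symbol and the quadratic Gauss sum\<close>

context
  fixes p :: nat
  assumes p: "prime p" "odd p"
begin

lemma p_gt_2: "p > 2"
  using p prime_gt_1_nat[of p] by (cases "p = 2") auto

lemma prime_int_p: "prime (int p)"
  using p by simp

lemma Legendre_eq_0_iff: "Legendre a (int p) = 0 \<longleftrightarrow> int p dvd a"
  by (simp add: Legendre_def cong_0_iff)

lemma Legendre_eq_1_iff: "Legendre a (int p) = 1 \<longleftrightarrow> \<not> int p dvd a \<and> QuadRes (int p) a"
  by (simp add: Legendre_def cong_0_iff)

lemma Legendre_range: "Legendre a (int p) \<in> {- 1, 0, 1}"
  by (simp add: Legendre_def)

lemma Legendre_mod: "Legendre (a mod int p) (int p) = Legendre a (int p)"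
  by (simp add: Legendre_def QuadRes_def cong_def)

text \<open>Euler's criterion gives the congruence modulo \<open>p\<close>; the two sides differ by
  at most 2, which is less than \<open>p\<close>, so they are equal.\<close>

lemma Legendre_mult: "Legendre (a * b) (int p) = Legendre a (int p) * Legendre b (int p)"
proof -
  have e: "[Legendre c (int p) = c ^ ((p - 1) div 2)] (mod int p)" for c
    using euler_criterion[OF p(1) p_gt_2] .
  have "[Legendre (a * b) (int p) = Legendre a (int p) * Legendre b (int p)] (mod int p)"
    using cong_trans[OF e[of "a * b"]] cong_sym[OF cong_mult[OF e[of a] e[of b]]]
    by (simp add: power_mult_distrib)
  then have "int p dvd Legendre (a * b) (int p) - Legendre a (int p) * Legendre b (int p)"
    by (simp add: cong_iff_dvd_diff)
  moreover have "\<bar>Legendre (a * b) (int p) - Legendre a (int p) * Legendre b (int p)\<bar> < int p"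
    using Legendre_range[of a] Legendre_range[of b] Legendre_range[of "a * b"] p_gt_2 by auto
  ultimately show ?thesis
    using dvd_imp_le_int[of "Legendre (a * b) (int p) - Legendre a (int p) * Legendre b (int p)" "int p"]
    by fastforce
qed

text \<open>Otherwise squaring would be surjective on the residues, hence injective, yet
  \<open>1\<close> and \<open>p - 1\<close> have the same square.\<close>

lemma nonresidue_exists: "\<exists>g. Legendre g (int p) = - 1"
proof (rule ccontr)
  assume no: "\<nexists>g. Legendre g (int p) = - 1"
  let ?A = "{0..<int p}" and ?f = "\<lambda>y. y\<^sup>2 mod int p"
  have "?f ` ?A = ?A"
  proof (intro equalityI subsetI)
    fix r assume r: "r \<in> ?A"
    have "\<exists>y. [y\<^sup>2 = r] (mod int p)"
    proof (cases "r = 0")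
      case True
      then show ?thesis by (intro exI[of _ 0]) simp
    next
      case False
      then have "\<not> int p dvd r"
        using r by (auto dest: zdvd_imp_le)
      moreover have "Legendre r (int p) \<noteq> - 1"
        using no by blast
      ultimately show ?thesis
        using Legendre_range[of r] Legendre_eq_0_iff[of r] Legendre_eq_1_iff[of r]
        by (auto simp: QuadRes_def)
    qed
    then obtain y where "[y\<^sup>2 = r] (mod int p)" ..
    then have "y\<^sup>2 mod int p = r mod int p"
      by (simp only: cong_iff_dvd_diff mod_eq_dvd_iff)
    then have "?f (y mod int p) = r"
      using r by (simp add: power_mod)
    moreover have "y mod int p \<in> ?A"
      using p_gt_2 by simp
    ultimately show "r \<in> ?f ` ?A" by blast
  qed (use p_gt_2 in auto)
  then have "inj_on ?f ?A"
    by (intro eq_card_imp_inj_on) simp_all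
  moreover have "?f 1 = ?f (int p - 1)"
    unfolding mod_eq_dvd_iff by (auto simp: power2_eq_square algebra_simps intro!: dvd_diff)
  ultimately show False
    using p_gt_2 by (auto dest!: inj_onD[where x = 1 and y = "int p - 1"])
qed

lemma sum_mult_residues:
  assumes x: "\<not> int p dvd x"
  shows "(\<Sum>r\<in>{0..<int p}. f ((x * r) mod int p)) = (\<Sum>r\<in>{0..<int p}. f r)"
proof -
  let ?A = "{0..<int p}" and ?g = "\<lambda>r. (x * r) mod int p"
  have inj: "inj_on ?g ?A"
  proof (rule inj_onI)
    fix r r' assume r: "r \<in> ?A" "r' \<in> ?A" and "?g r = ?g r'"
    then have "int p dvd x * (r - r')"
      by (simp add: mod_eq_dvd_iff right_diff_distrib)
    then have "int p dvd r - r'"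
      using x prime_int_p prime_dvd_mult_iff by blast
    then have "[r = r'] (mod int p)"
      by (simp add: cong_iff_dvd_diff)
    then show "r = r'"
      using r by (intro cong_less_imp_eq_int) auto
  qed
  have "?g ` ?A = ?A"
    using p_gt_2 by (intro endo_inj_surj inj) auto
  then show ?thesis
    using sum.reindex[OF inj, of f] by (simp add: comp_def)
qed

text \<open>Multiplication by a nonresidue permutes the residues and flips the sign of the
  sum.\<close>

lemma sum_Legendre: "(\<Sum>r\<in>{0..<int p}. Legendre r (int p)) = 0"
proof -
  obtain g where g: "Legendre g (int p) = - 1"
    using nonresidue_exists ..
  then have "\<not> int p dvd g"
    using Legendre_eq_0_iff[of g] by simp
  then have "(\<Sum>r\<in>{0..<int p}. Legendre r (int p)) = (\<Sum>r\<in>{0..<int p}. Legendre ((g * r) mod int p) (int p))"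
    by (rule sum_mult_residues[symmetric])
  also have "\<dots> = - (\<Sum>r\<in>{0..<int p}. Legendre r (int p))"
    by (simp add: Legendre_mod Legendre_mult g sum_negf)
  finally show ?thesis by simp
qed

definition gauss_sum :: "int \<Rightarrow> complex" where
  "gauss_sum x = (\<Sum>r\<in>{0..<int p}. of_int (Legendre r (int p)) * rot p (x * r))"

lemma gauss_sum_dvd:
  assumes "int p dvd x"
  shows "gauss_sum x = 0"
proof -
  have "rot p (x * r) = 1" for r
    using assms p_gt_2 by (simp add: rot_eq_1_iff)
  then show ?thesis
    by (simp add: gauss_sum_def sum_Legendre flip: of_int_sum)
qed

lemma Legendre_square: "\<not> int p dvd x \<Longrightarrow> Legendre x (int p) * Legendre x (int p) = 1"
  using Legendre_range[of x] Legendre_eq_0_iff[of x] by auto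

text \<open>Substituting \<open>x * r\<close> for \<open>r\<close> in \<open>gauss_sum 1\<close>
  pulls out the symbol of \<open>x\<close>, which is its own inverse.\<close>

lemma gauss_sum_eq:
  assumes x: "\<not> int p dvd x"
  shows "gauss_sum x = of_int (Legendre x (int p)) * gauss_sum 1"
proof -
  have "gauss_sum 1 = (\<Sum>r\<in>{0..<int p}. of_int (Legendre ((x * r) mod int p) (int p)) * rot p ((x * r) mod int p))"
    unfolding gauss_sum_def mult_1 by (rule sum_mult_residues[OF x, symmetric])
  also have "\<dots> = (\<Sum>r\<in>{0..<int p}. of_int (Legendre x (int p)) * (of_int (Legendre r (int p)) * rot p (x * r)))"
  proof (intro sum.cong refl)
    fix r
    have "rot p ((x * r) mod int p) = rot p (x * r)"
      using p_gt_2 by (intro rot_cong) (simp_all add: cong_def)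
    then show "of_int (Legendre ((x * r) mod int p) (int p)) * rot p ((x * r) mod int p)
      = of_int (Legendre x (int p)) * (of_int (Legendre r (int p)) * rot p (x * r))"
      by (simp add: Legendre_mod Legendre_mult)
  qed
  finally have "gauss_sum 1 = of_int (Legendre x (int p)) * gauss_sum x"
    by (simp only: gauss_sum_def sum_distrib_left)
  then have "of_int (Legendre x (int p)) * gauss_sum 1
    = of_int (Legendre x (int p) * Legendre x (int p)) * gauss_sum x"
    by (simp only: of_int_mult mult.assoc)
  then show ?thesis
    by (simp only: Legendre_square[OF x] of_int_1 mult_1)
qed

text \<open>Parseval: \<open>\<bar>G(x)\<bar>\<^sup>2\<close> summed over all residues \<open>x\<close> is \<open>p (p - 1)\<close>, and the summand is the same for all
  \<open>x \<noteq> 0\<close>.\<close>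

lemma gauss_sum_norm: "gauss_sum 1 * cnj (gauss_sum 1) = of_nat p"
proof -
  let ?A = "{0..<int p}" and ?\<chi> = "\<lambda>r. of_int (Legendre r (int p)) :: complex"
  have "(\<Sum>x<p. gauss_sum (int x) * cnj (gauss_sum (int x)))
     = (\<Sum>x<p. \<Sum>r\<in>?A. \<Sum>r'\<in>?A. ?\<chi> r * ?\<chi> r' * rot p (int x * (r - r')))"
    unfolding gauss_sum_def cnj_sum sum_product
  proof (intro sum.cong refl)
    fix x r r'
    have "rot p (int x * (r - r')) = rot p (int x * r) * rot p (- (int x * r'))"
      unfolding rot_add[symmetric] by (simp add: right_diff_distrib)
    then show "?\<chi> r * rot p (int x * r) * cnj (?\<chi> r' * rot p (int x * r'))
        = ?\<chi> r * ?\<chi> r' * rot p (int x * (r - r'))"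
      by (simp add: rot_minus)
  qed
  \<comment> \<open>With \<open>x\<close> innermost, orthogonality keeps only the diagonal
    \<open>r = r'\<close>.\<close>
  also have "\<dots> = (\<Sum>r\<in>?A. \<Sum>r'\<in>?A. \<Sum>x<p. ?\<chi> r * ?\<chi> r' * rot p (int x * (r - r')))"
    by (subst sum.swap, intro sum.cong refl, rule sum.swap)
  also have "\<dots> = (\<Sum>r\<in>?A. \<Sum>r'\<in>?A. if r = r' then ?\<chi> r * ?\<chi> r * of_nat p else 0)"
  proof (intro sum.cong refl)
    fix r r' assume r: "r \<in> ?A" "r' \<in> ?A"
    have "int p dvd r - r' \<longleftrightarrow> r = r'"
      using r cong_less_imp_eq_int[of r "int p" r'] by (auto simp: cong_iff_dvd_diff)
    then show "(\<Sum>x<p. ?\<chi> r * ?\<chi> r' * rot p (int x * (r - r')))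
        = (if r = r' then ?\<chi> r * ?\<chi> r * of_nat p else 0)"
      using p_gt_2 unfolding sum_distrib_left[symmetric] by (simp add: sum_rot)
  qed
  also have "\<dots> = (\<Sum>r\<in>?A. ?\<chi> r * ?\<chi> r * of_nat p)"
    by simp
  also have "\<dots> = (\<Sum>r\<in>?A - {0}. of_nat p)"
  proof (rule sum.mono_neutral_cong_right)
    show "\<forall>r\<in>?A - (?A - {0}). ?\<chi> r * ?\<chi> r * of_nat p = 0"
      by (auto simp: Legendre_eq_0_iff)
    fix r assume "r \<in> ?A - {0}"
    then have "\<not> int p dvd r" by (auto dest: zdvd_imp_le)
    then show "?\<chi> r * ?\<chi> r * of_nat p = of_nat p"
      using Legendre_square[of r] by (simp flip: of_int_mult)
  qed auto
  also have "\<dots> = of_nat (p - 1) * of_nat p"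
    using p_gt_2 by (simp add: nat_diff_distrib)
  finally have total: "(\<Sum>x<p. gauss_sum (int x) * cnj (gauss_sum (int x))) = of_nat (p - 1) * of_nat p" .
  have "(\<Sum>x<p. gauss_sum (int x) * cnj (gauss_sum (int x))) = (\<Sum>x\<in>{..<p} - {0}. gauss_sum 1 * cnj (gauss_sum 1))"
  proof (rule sum.mono_neutral_cong_right)
    show "\<forall>x\<in>{..<p} - ({..<p} - {0}). gauss_sum (int x) * cnj (gauss_sum (int x)) = 0"
      by (auto simp: gauss_sum_dvd)
    fix x assume "x \<in> {..<p} - {0}"
    then have x: "\<not> int p dvd int x" by (auto dest: zdvd_imp_le)
    have "gauss_sum (int x) * cnj (gauss_sum (int x))
      = of_int (Legendre (int x) (int p) * Legendre (int x) (int p)) * (gauss_sum 1 * cnj (gauss_sum 1))"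
      unfolding gauss_sum_eq[OF x] by simp
    then show "gauss_sum (int x) * cnj (gauss_sum (int x)) = gauss_sum 1 * cnj (gauss_sum 1)"
      by (simp only: Legendre_square[OF x] of_int_1 mult_1)
  qed auto
  then have "of_nat (p - 1) * (gauss_sum 1 * cnj (gauss_sum 1)) = of_nat (p - 1) * of_nat p"
    using total p_gt_2 by simp
  moreover have "of_nat (p - 1) \<noteq> (0 :: complex)"
    using p_gt_2 by simp
  ultimately show ?thesis
    by (rule mult_left_cancel[THEN iffD1, rotated])
qed

text \<open>If -1 is a residue, the sum equals its conjugate, so \<open>gauss_sum_norm\<close>
  evaluates its square. The sign of \<open>g\<close> stays open.\<close>

lemma gauss_sum_real:
  assumes "Legendre (- 1) (int p) = 1"
  obtains g :: real where "g\<^sup>2 = p" "gauss_sum 1 = of_real g"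
proof -
  have n1: "\<not> int p dvd - 1"
    using p_gt_2 by simp
  have "cnj (gauss_sum 1) = gauss_sum (- 1)"
    unfolding gauss_sum_def by (simp add: rot_minus)
  then have c: "cnj (gauss_sum 1) = gauss_sum 1"
    using gauss_sum_eq[OF n1] assms by simp
  then have g: "gauss_sum 1 = of_real (Re (gauss_sum 1))"
    by (simp add: complex_eq_iff)
  have "complex_of_real ((Re (gauss_sum 1))\<^sup>2) = of_real p"
    using gauss_sum_norm unfolding c by (subst (asm) (1 2) g) (simp add: power2_eq_square)
  then have "(Re (gauss_sum 1))\<^sup>2 = p"
    by (simp only: of_real_eq_iff)
  then show thesis using g that by blast
qed

lemma sum_rot_residues: "(\<Sum>r\<in>{0..<int p}. rot p (x * r)) = (if int p dvd x then of_nat p else 0)"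
proof -
  have "(\<Sum>r\<in>{0..<int p}. rot p (x * r)) = (\<Sum>j<p. rot p (int j * x))"
    using sum.atLeast_int_lessThan_int_shift[of "\<lambda>r. rot p (x * r)" 0 p]
    by (simp add: atLeast0LessThan comp_def mult.commute)
  then show ?thesis
    using p_gt_2 by (simp add: sum_rot)
qed

section \<open>The spectrum for twice an odd prime\<close>

lemma QuadRes_odd_root:
  assumes "QuadRes (int p) r"
  obtains u where "odd u" "[u\<^sup>2 = r] (mod int p)"
proof -
  obtain y where y: "[y\<^sup>2 = r] (mod int p)"
    using assms unfolding QuadRes_def ..
  \<comment> \<open>Adding the odd number \<open>p\<close> changes the parity but not the class
    modulo \<open>p\<close>.\<close>
  define u where "u = (if odd y then y else y + int p)"
  have "[u = y] (mod int p)"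
    by (simp add: u_def cong_iff_dvd_diff)
  then have "[u\<^sup>2 = r] (mod int p)"
    using y cong_pow cong_trans by blast
  moreover have "odd u"
    using p by (simp add: u_def)
  ultimately show thesis by (rule that[rotated])
qed

text \<open>Chinese remainder theorem: modulo 2 membership only means being odd, and modulo
  \<open>p\<close> it means being a nonzero square up to sign.\<close>

lemma in_quc_set_double_prime:
  "s \<in> quc_set (2 * p) \<longleftrightarrow> 0 \<le> s \<and> s < 2 * int p \<and> odd s \<and>
    (Legendre s (int p) = 1 \<or> Legendre (- s) (int p) = 1)"
proof
  assume s: "s \<in> quc_set (2 * p)"
  then obtain u where u: "[s = u\<^sup>2] (mod int (2 * p)) \<or> [s = - u\<^sup>2] (mod int (2 * p))"
    by (auto simp: quc_set_def)
  have d: "int p dvd int (2 * p)" by simp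
  have "[u\<^sup>2 = s] (mod int p) \<or> [u\<^sup>2 = - s] (mod int p)"
    using u
  proof
    assume "[s = u\<^sup>2] (mod int (2 * p))"
    from cong_sym[OF cong_dvd_modulus[OF this d]] show ?thesis ..
  next
    assume "[s = - u\<^sup>2] (mod int (2 * p))"
    from cong_sym[OF cong_dvd_modulus[OF this d]] have "[u\<^sup>2 = - s] (mod int p)"
      using cong_minus_minus_iff[of "u\<^sup>2" "- s" "int p"] by simp
    then show ?thesis ..
  qed
  then have "QuadRes (int p) s \<or> QuadRes (int p) (- s)"
    by (auto simp: QuadRes_def)
  moreover have "\<not> int p dvd s" "odd s"
    using not_dvd_quc_set[OF s, of p] not_dvd_quc_set[OF s, of 2] p_gt_2 by simp_all
  ultimately show "0 \<le> s \<and> s < 2 * int p \<and> odd s \<and>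
      (Legendre s (int p) = 1 \<or> Legendre (- s) (int p) = 1)"
    using s by (simp add: Legendre_eq_1_iff quc_set_def)
next
  assume s: "0 \<le> s \<and> s < 2 * int p \<and> odd s \<and>
    (Legendre s (int p) = 1 \<or> Legendre (- s) (int p) = 1)"
  then have ps: "\<not> int p dvd s" and "QuadRes (int p) s \<or> QuadRes (int p) (- s)"
    by (auto simp: Legendre_eq_1_iff)
  \<comment> \<open>The sign \<open>e\<close> records which of \<open>s\<close> and
    \<open>- s\<close> is the residue.\<close>
  then obtain e u :: int where e: "odd e" "\<bar>e\<bar> = 1" and u: "odd u" "[u\<^sup>2 = e * s] (mod int p)"
    by (auto elim!: QuadRes_odd_root intro: that[of 1] that[of "- 1"])
  have "\<not> int p dvd u"
  proof
    assume "int p dvd u"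
    then have "int p dvd u\<^sup>2" by (simp add: power2_eq_square)
    then have "int p dvd e * s" using u(2) cong_dvd_iff by blast
    then show False using ps e by (auto simp: abs_if split: if_splits)
  qed
  then have "coprime u (int p)"
    using prime_imp_coprime[OF prime_int_p, of u] by (simp add: coprime_commute)
  then have cop: "coprime u (int (2 * p))"
    using u(1) by simp
  have "[u\<^sup>2 = e * s] (mod 2)"
    using u(1) e(1) s by (simp add: cong_iff_dvd_diff)
  moreover have "coprime 2 (int p)"
    using p by simp
  ultimately have us: "[u\<^sup>2 = e * s] (mod int (2 * p))"
    using coprime_cong_mult[OF _ u(2)] by simp
  have "e = 1 \<or> e = - 1"
    using e(2) by arith
  then have "[s = u\<^sup>2] (mod int (2 * p)) \<or> [s = - u\<^sup>2] (mod int (2 * p))"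
    using cong_sym[OF us] cong_minus_minus_iff[of s "- u\<^sup>2" "int (2 * p)"]
    by (elim disjE) simp_all
  then show "s \<in> quc_set (2 * p)"
    using s cop by (auto simp: quc_set_def)
qed

text \<open>Reduction modulo \<open>p\<close> is a bijection from the odd residues modulo
  \<open>2 * p\<close>; its inverse adds \<open>p\<close> to even representatives. At an even index
  the character modulo \<open>2 * p\<close> is one modulo \<open>p\<close>.\<close>

lemma sum_quc_set_double_prime:
  "(\<Sum>s\<in>quc_set (2 * p). rot (2 * p) (2 * x * s))
    = (\<Sum>r | r \<in> {0..<int p} \<and> (Legendre r (int p) = 1 \<or> Legendre (- r) (int p) = 1). rot p (x * r))"
proof (rule sum.reindex_bij_witness[where i = "\<lambda>r. if odd r then r else r + int p"
      and j = "\<lambda>s. s mod int p"])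
  have Lm: "Legendre a (int p) = Legendre b (int p)" "Legendre (- a) (int p) = Legendre (- b) (int p)"
    if "a mod int p = b mod int p" for a b
    using that Legendre_mod mod_minus_cong by metis+
  {
    fix s assume s: "s \<in> quc_set (2 * p)"
    show "(if odd (s mod int p) then s mod int p else s mod int p + int p) = s"
    proof (cases "s < int p")
      case True
      then show ?thesis
        using s by (simp add: in_quc_set_double_prime)
    next
      case False
      have "s mod int p = (s - int p) mod int p" by simp
      also have "\<dots> = s - int p"
        using s False by (intro mod_pos_pos_trivial) (simp_all add: in_quc_set_double_prime)
      finally show ?thesis
        using s p by (simp add: in_quc_set_double_prime)
    qed
    show "s mod int p \<in> {r \<in> {0..<int p}. Legendre r (int p) = 1 \<or> Legendre (- r) (int p) = 1}"
      using s Lm[of "s mod int p" s] p_gt_2 by (simp add: in_quc_set_double_prime)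
    have "rot p (x * (s mod int p)) = rot p (x * s)"
      using p_gt_2 by (intro rot_cong cong_scalar_left) (simp_all add: cong_def)
    also have "\<dots> = rot (2 * p) (2 * x * s)"
      using rot_cancel[of 2 p "x * s"] by (simp add: mult.assoc)
    finally show "rot p (x * (s mod int p)) = rot (2 * p) (2 * x * s)" .
  }
  fix r assume r: "r \<in> {r \<in> {0..<int p}. Legendre r (int p) = 1 \<or> Legendre (- r) (int p) = 1}"
  show "(if odd r then r else r + int p) mod int p = r"
    using r by simp
  then show "(if odd r then r else r + int p) \<in> quc_set (2 * p)"
    using r p Lm[of "if odd r then r else r + int p" r] by (auto simp: in_quc_set_double_prime)
qed

interpretation circulant "2 * p" "quc_set (2 * p)" "quc_adj (2 * p)"
  by (rule circulant_quc) (use p_gt_2 in simp)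

text \<open>All connecting elements are odd, so the shift by \<open>p\<close> multiplies each term
  by \<open>rot 2 s = - 1\<close>.\<close>

lemma ev_add_p: "ev (2 * x + int p) = - ev (2 * x)"
proof -
  have "rot (2 * p) ((2 * x + int p) * s) = - rot (2 * p) (2 * x * s)" if "s \<in> quc_set (2 * p)" for s
  proof -
    have "odd s" using that by (simp add: in_quc_set_double_prime)
    then obtain i where i: "s = 2 * i + 1" by (elim oddE)
    have "rot (2 * p) (int p * s) = rot 2 s"
      using rot_cancel[of p 2 s] p_gt_2 by (simp add: mult.commute)
    also have "\<dots> = rot 2 (2 * i) * rot 2 1"
      by (simp only: i rot_add)
    also have "rot 2 (2 * i) = 1"
      by (simp add: rot_eq_1_iff)
    also have "rot 2 1 = - 1"
      by (simp add: rot_def)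
    finally show ?thesis
      by (simp add: distrib_right rot_add)
  qed
  then have "complex_of_real (ev (2 * x + int p)) = complex_of_real (- ev (2 * x))"
    unfolding of_real_minus ev_rot sum_negf[symmetric] by (intro sum.cong refl)
  then show ?thesis
    by (simp only: of_real_eq_iff)
qed

text \<open>Exactly one of \<open>r\<close> and \<open>- r\<close> is a residue when
  \<open>r\<close> is nonzero, so the sum runs over all nonzero classes.\<close>

lemma ev_even_nonresidue:
  assumes "Legendre (- 1) (int p) = - 1"
  shows "ev (2 * x) = (if int p dvd x then real p - 1 else - 1)"
proof -
  have "Legendre r (int p) = 1 \<or> Legendre (- r) (int p) = 1 \<longleftrightarrow> \<not> int p dvd r" for r
    using Legendre_mult[of "- 1" r] Legendre_range[of r] Legendre_eq_0_iff[of r] assms by auto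
  then have "complex_of_real (ev (2 * x)) = (\<Sum>r | r \<in> {0..<int p} \<and> \<not> int p dvd r. rot p (x * r))"
    by (simp only: ev_rot sum_quc_set_double_prime)
  also have "{r. r \<in> {0..<int p} \<and> \<not> int p dvd r} = {0..<int p} - {0}"
    using p_gt_2 by (auto dest: zdvd_imp_le)
  also have "(\<Sum>r\<in>{0..<int p} - {0}. rot p (x * r)) = (if int p dvd x then of_nat p else 0) - 1"
    using p_gt_2 by (subst sum_diff) (simp_all add: sum_rot_residues)
  also have "\<dots> = complex_of_real (if int p dvd x then real p - 1 else - 1)"
    by simp
  finally show ?thesis
    by (simp only: of_real_eq_iff)
qed

text \<open>Now \<open>r\<close> and \<open>- r\<close> are residues together, and
  \<open>(1 + \<chi> r) / 2\<close> is the indicator of the residues among nonzero \<open>r\<close>;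
  this splits the eigenvalue into a complete character sum and a Gauss sum.\<close>

lemma ev_even_residue:
  assumes "Legendre (- 1) (int p) = 1"
  shows "ev (2 * x) \<in> (if int p dvd x then {(real p - 1) / 2} else {(- 1 + sqrt p) / 2, (- 1 - sqrt p) / 2})"
proof -
  let ?\<chi> = "\<lambda>r. of_int (Legendre r (int p)) :: complex"
  obtain g where g: "g\<^sup>2 = real p" "gauss_sum 1 = of_real g"
    using gauss_sum_real[OF assms] .
  have "Legendre (- r) (int p) = Legendre r (int p)" for r
    using Legendre_mult[of "- 1" r] assms by simp
  then have "complex_of_real (ev (2 * x)) = (\<Sum>r | r \<in> {0..<int p} \<and> Legendre r (int p) = 1. rot p (x * r))"
    by (simp only: ev_rot sum_quc_set_double_prime disj_absorb)
  also have "\<dots> = (\<Sum>r\<in>{0..<int p} - {0}. (1 + ?\<chi> r) / 2 * rot p (x * r))"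
  proof (rule sum.mono_neutral_cong_left)
    show "{r \<in> {0..<int p}. Legendre r (int p) = 1} \<subseteq> {0..<int p} - {0}"
      using Legendre_eq_0_iff[of 0] by auto
    show "\<forall>r\<in>{0..<int p} - {0} - {r \<in> {0..<int p}. Legendre r (int p) = 1}. (1 + ?\<chi> r) / 2 * rot p (x * r) = 0"
    proof
      fix r assume r: "r \<in> {0..<int p} - {0} - {r \<in> {0..<int p}. Legendre r (int p) = 1}"
      then have "\<not> int p dvd r" by (auto dest: zdvd_imp_le)
      then have "Legendre r (int p) = - 1"
        using r Legendre_range[of r] Legendre_eq_0_iff[of r] by auto
      then show "(1 + ?\<chi> r) / 2 * rot p (x * r) = 0" by simp
    qed
  qed auto
  \<comment> \<open>The symbol of 0 is 0, so the added term at \<open>r = 0\<close> contributes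
    \<open>1 / 2\<close>.\<close>
  also have "\<dots> = (\<Sum>r\<in>{0..<int p}. (1 + ?\<chi> r) / 2 * rot p (x * r)) - 1 / 2"
    using p_gt_2 Legendre_eq_0_iff[of 0] by (subst sum_diff) simp_all
  also have "(\<Sum>r\<in>{0..<int p}. (1 + ?\<chi> r) / 2 * rot p (x * r))
    = ((\<Sum>r\<in>{0..<int p}. rot p (x * r)) + gauss_sum x) / 2"
    unfolding gauss_sum_def sum.distrib[symmetric] sum_divide_distrib
    by (intro sum.cong refl) (simp add: algebra_simps)
  finally have ev: "complex_of_real (ev (2 * x)) = ((if int p dvd x then of_nat p else 0) + gauss_sum x) / 2 - 1 / 2"
    by (simp only: sum_rot_residues)
  show ?thesis
  proof (cases "int p dvd x")
    case True
    then have "complex_of_real (ev (2 * x)) = complex_of_real ((real p - 1) / 2)"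
      using ev by (simp add: gauss_sum_dvd diff_divide_distrib)
    then show ?thesis
      using True by (simp only: of_real_eq_iff if_True singleton_iff)
  next
    case False
    have "Legendre x (int p) = 1 \<or> Legendre x (int p) = - 1"
      using False Legendre_range[of x] Legendre_eq_0_iff[of x] by auto
    moreover have "g = sqrt p \<or> g = - sqrt p"
      using g(1) by (metis of_nat_0_le_iff power2_eq_iff real_sqrt_pow2)
    ultimately have gx: "gauss_sum x = of_real (sqrt p) \<or> gauss_sum x = of_real (- sqrt p)"
      using gauss_sum_eq[OF False] g(2) by auto
    have "complex_of_real (ev (2 * x)) = complex_of_real ((- 1 + sqrt p) / 2) \<or>
      complex_of_real (ev (2 * x)) = complex_of_real ((- 1 - sqrt p) / 2)"
      using gx False by (auto simp: ev add_divide_distrib diff_divide_distrib)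
    then show ?thesis
      using False by (simp only: of_real_eq_iff if_False insert_iff empty_iff simp_thms)
  qed
qed

end

section \<open>Revival times for twice an odd prime\<close>

context
  fixes p :: nat
  assumes p: "prime p" "odd p"
begin

interpretation circulant "2 * p" "quc_set (2 * p)" "quc_adj (2 * p)"
  by (rule circulant_quc) (use p_gt_2[OF p] in simp)

text \<open>Every odd index has the form \<open>2 * x + p\<close>, so by \<open>ev_add_p\<close> its
  phase tends to the conjugate limit. That differs from \<open>rot p 1\<close>, which is not real
  for \<open>p > 2\<close>. By \<open>limit_power_eq_1\<close> only \<open>p\<close>-th roots of
  unity can be limits.\<close>

lemma pgfr_double_primeI:
  assumes conv: "\<And>x. (\<lambda>k. cis (- t k * ev (2 * x))) \<longlonglongrightarrow> rot p 1"
  shows "admits_pgfr (2 * p) (quc_adj (2 * p))"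
proof (rule convergence_imp_pgfr[of "rot p 1" "cnj (rot p 1)" t])
  show "rot p 1 \<noteq> cnj (rot p 1)"
  proof
    assume "rot p 1 = cnj (rot p 1)"
    then have "rot p 1 * rot p 1 = rot p (1 + - 1)"
      by (simp only: rot_add rot_minus)
    then have "rot p 2 = 1"
      using rot_add[of p 1 1] by simp
    then have "int p dvd 2"
      using rot_eq_1_iff p_gt_2[OF p] by simp
    then show False
      using zdvd_imp_le[of "int p" 2] p_gt_2[OF p] by simp
  qed
  fix j
  show "(\<lambda>k. cis (- t k * ev j)) \<longlonglongrightarrow> (if even j then rot p 1 else cnj (rot p 1))"
  proof (cases "even j")
    case True
    then obtain x where "j = 2 * x" ..
    then show ?thesis using conv[of x] by simp
  next
    case False
    then have "even (j - int p)" using p by simp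
    then obtain x where "j - int p = 2 * x" ..
    then have j: "j = 2 * x + int p" by simp
    have "(\<lambda>k. cnj (cis (- t k * ev (2 * x)))) \<longlonglongrightarrow> cnj (rot p 1)"
      by (intro tendsto_cnj conv)
    then show ?thesis
      using False by (simp add: j ev_add_p[OF p] cis_cnj)
  qed
qed simp

lemma pgfr_double_prime: "admits_pgfr (2 * p) (quc_adj (2 * p))"
proof -
  have p0: "real p > 0" using p_gt_2[OF p] by simp
  have rot1: "rot p 1 = cis (2 * pi / p)"
    by (simp add: rot_def)
  have "Legendre (- 1) (int p) \<noteq> 0"
    using p_gt_2[OF p] by (simp add: Legendre_eq_0_iff[OF p])
  then consider "Legendre (- 1) (int p) = - 1" | "Legendre (- 1) (int p) = 1"
    using Legendre_range[OF p, of "- 1"] by auto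
  then show ?thesis
  proof cases
    case 1
    show ?thesis
    \<comment> \<open>The eigenvalues \<open>p - 1\<close> and \<open>-1\<close> agree modulo
      \<open>p\<close>, so one constant time suffices.\<close>
    proof (rule pgfr_double_primeI[of "\<lambda>_. 2 * pi / p"])
      fix x
      have "cis (- (2 * pi / p) * ev (2 * x)) = rot p 1"
      proof (cases "int p dvd x")
        case True
        then have "ev (2 * x) = real p - 1"
          by (simp only: ev_even_nonresidue[OF p 1] if_True)
        then have "- (2 * pi / p) * ev (2 * x) = 2 * pi / p - 2 * pi"
          using p0 by (simp add: divide_simps) (simp add: algebra_simps)
        then show ?thesis
          by (simp add: rot1 cis_divide[symmetric])
      next
        case False
        then show ?thesis
          by (simp add: ev_even_nonresidue[OF p 1] rot1)
      qed
      then show "(\<lambda>k. cis (- (2 * pi / p) * ev (2 * x))) \<longlonglongrightarrow> rot p 1"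
        by simp
    qed
  next
    case 2
    have inv: "1 / sqrt p = 1 / p * sqrt p"
      using p0 real_div_sqrt[of p] by (simp add: divide_simps)
    \<comment> \<open>The offset is chosen so that the angle equals
      \<open>2 * pi * (h k + 1 / p) * sqrt p\<close>, by \<open>inv\<close>.\<close>
    obtain h :: "nat \<Rightarrow> int" where h: "(\<lambda>k. cis (2 * pi * (h k * sqrt p - - (1 / sqrt p)))) \<longlonglongrightarrow> 1"
      using cis_approx[OF sqrt_prime_irrational[OF p(1)]] .
    let ?a = "\<lambda>k. 2 * pi * (h k * sqrt p - - (1 / sqrt p))"
    have h': "(\<lambda>k. cis (- ?a k)) \<longlonglongrightarrow> 1"
      using tendsto_cnj[OF h] by (simp add: cis_cnj)
    have a: "?a k = 2 * pi * (h k + 1 / p) * sqrt p" for k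
      unfolding inv by (simp add: algebra_simps)
    show ?thesis
    \<comment> \<open>At these times \<open>(p - 1) / 2\<close> and the rational part
      \<open>- 1 / 2\<close> of the other eigenvalues both give the phase \<open>rot p 1\<close>
      exactly; the part with \<open>sqrt p\<close> adds the angle \<open>?a k\<close> up to sign,
      which tends to 0 modulo \<open>2 * pi\<close>.\<close>
    proof (rule pgfr_double_primeI[of "\<lambda>k. 4 * pi * (h k + 1 / p)"])
      fix x
      let ?c = "\<lambda>k. cis (- (4 * pi * (h k + 1 / p)) * ev (2 * x))"
      have red: "cis (2 * pi * (h k + 1 / p) + y) = rot p 1 * cis y" for k y
      proof -
        have "2 * pi * (h k + 1 / p) + y = 2 * pi * of_int (h k) + (2 * pi / p + y)"
          by (simp add: algebra_simps)
        then show ?thesis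
          by (simp only: cis_mult[symmetric] cis_multiple_2pi[OF Ints_of_int] mult_1 rot1)
      qed
      consider "ev (2 * x) = (real p - 1) / 2" | "ev (2 * x) = (- 1 + sqrt p) / 2"
        | "ev (2 * x) = (- 1 - sqrt p) / 2"
        using ev_even_residue[OF p 2, of x] by (auto split: if_splits)
      then show "?c \<longlonglongrightarrow> rot p 1"
      proof cases
        case 1
        have "- (4 * pi * (h k + 1 / p)) * ev (2 * x)
          = 2 * pi * (h k + 1 / p) + 2 * pi * of_int (- h k * int p - 1)" for k
          unfolding 1 using p0 by (simp add: field_simps)
        then have "?c k = rot p 1" for k
          by (simp only: red cis_multiple_2pi[OF Ints_of_int] mult_1_right)
        then show ?thesis by simp
      next
        case 2
        have "- (4 * pi * (h k + 1 / p)) * ev (2 * x) = 2 * pi * (h k + 1 / p) + - ?a k" for k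
          unfolding a 2 by (simp add: add_divide_distrib diff_divide_distrib algebra_simps)
        then have "?c = (\<lambda>k. rot p 1 * cis (- ?a k))"
          by (simp only: red)
        then show ?thesis
          using tendsto_mult[OF tendsto_const h', of "rot p 1"] by simp
      next
        case 3
        have "- (4 * pi * (h k + 1 / p)) * ev (2 * x) = 2 * pi * (h k + 1 / p) + ?a k" for k
          unfolding a 3 by (simp add: add_divide_distrib diff_divide_distrib algebra_simps)
        then have "?c = (\<lambda>k. rot p 1 * cis (?a k))"
          by (simp only: red)
        then show ?thesis
          using tendsto_mult[OF tendsto_const h, of "rot p 1"] by simp
      qed
    qed
  qed
qed

end

theorem theorem6p13:
  fixes n :: nat
  assumes "n > 0"
  shows "admits_pgfr n (quc_adj n) \<longleftrightarrow> n \<in> {2, 8} \<union> {2 * p | p :: nat. prime p}"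
proof
  assume "admits_pgfr n (quc_adj n)"
  with assms show "n \<in> {2, 8} \<union> {2 * p | p :: nat. prime p}"
    by (rule pgfr_quc_imp)
next
  assume "n \<in> {2, 8} \<union> {2 * p | p :: nat. prime p}"
  then consider "n = 2" | "n = 8" | p where "prime p" "n = 2 * p"
    by auto
  then show "admits_pgfr n (quc_adj n)"
  proof cases
    case 3
    show ?thesis
    proof (cases "odd p")
      case True
      then show ?thesis using 3 pgfr_double_prime by simp
    next
      case False
      \<comment> \<open>The even prime accounts for order 4.\<close>
      then have "p = 2"
        using 3 primes_dvd_imp_eq two_is_prime_nat by blast
      then show ?thesis using 3 pgfr_4 by simp
    qed
  qed (use pgfr_2 pgfr_8 in simp_all)
qed

end
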